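(* Let $T$ be an integral domain, $M$ a nonzero maximal ideal of $T$, $k=T/M$, $\varphi:T\to k$ the canonical projection, $D$ a proper subring of $k$, and $R=\varphi^{-1}(D)$. Let $\ast$ be a star operation on $R$. Then $R$ is a P$\ast$MD if and only if $k$ is the quotient field of $D$, $D$ is a P$\ast_\varphi$MD, $T$ is a P$(\ast)_T$MD, and $T_M$ is a valuation domain.
   Context: For an integral domain $A$ with quotient field $K$, $\boldsymbol F(A)$ is the set of nonzero fractional ideals of $A$ and $\boldsymbol f(A)$ the set of nonzero finitely generated ones; $I^{-1}=(A:_K I)$. A star operation on $A$ is a map $\ast:\boldsymbol F(A)\to\boldsymbol F(A)$, $E\mapsto E^\ast$, such that for all $0\ne x\in K$ and $E,F\in\boldsymbol F(A)$: $(xA)^\ast=xA$ and $(xE)^\ast=xE^\ast$; $E\subseteq F$ implies $E^\ast\subseteq F^\ast$; $E\subseteq E^\ast=(E^\ast)^\ast$. Put $E^{\ast_f}=\bigcup\{F^\ast\mid F\in\boldsymbol f(A),\,F\subseteq E\}$; this is again a star operation. The $v$-operation is $E^{v_A}=(E^{-1})^{-1}$. Given a star operation $\ast$ on $A$, $A$ is a P$\ast$MD (Prüfer $\ast$-multiplication domain) if $(II^{-1})^{\ast_f}=A$ for each nonzero finitely generated fractional ideal $I$ of $A$. Projection: for a star operation $\ast$ on $R$, $\ast_\varphi$ is the star operation on $D$ given, for $F\in\boldsymbol F(D)$, by $F^{\ast_\varphi}=\bigcap\{y\,\varphi((\varphi^{-1}(y^{-1}F))^\ast)\mid y\in L,\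 F\subseteq yD\}$, $L$ being the quotient field of $D$; in this setting it equals $F^{\ast_\varphi}=(\varphi^{-1}(F))^\ast/M$. Extension: $R$ and $T$ have the same quotient field and $(R:T)=M\neq0$, so $\boldsymbol F(T)\subseteq\boldsymbol F(R)$; $(\ast)_T$ is the star operation on $T$ given by $E^{(\ast)_T}=E^\ast\cap E^{v_T}$ for $E\in\boldsymbol F(T)$. *)

theory Defs
  imports "HOL-Algebra.Ideal_Product" "HOL-Algebra.QuotRing" "HOL-Algebra.Subrings"
begin

text \<open>Throughout, a domain \<open>A\<close> is given as a subring of a field \<open>F\<close>, which may be larger than the
  quotient field of \<open>A\<close>: fractional ideals, colons and star operations are always taken inside
  the quotient field \<open>quot_field F A\<close>. This matters for \<open>D\<close>, which lies in \<open>k\<close> but need not have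
  \<open>k\<close> as its quotient field.\<close>

definition quot_field :: "('a, 'm) ring_scheme \<Rightarrow> 'a set \<Rightarrow> 'a set" where
  "quot_field F A = {a \<otimes>\<^bsub>F\<^esub> inv\<^bsub>F\<^esub> b | a b. a \<in> A \<and> b \<in> A \<and> b \<noteq> \<zero>\<^bsub>F\<^esub>}"

definition frac_ideals :: "('a, 'm) ring_scheme \<Rightarrow> 'a set \<Rightarrow> 'a set set" where
  "frac_ideals F A = {E. additive_subgroup E F \<and> E \<subseteq> quot_field F A \<and> E \<noteq> {\<zero>\<^bsub>F\<^esub>} \<and>
     (\<forall>a\<in>A. \<forall>x\<in>E. a \<otimes>\<^bsub>F\<^esub> x \<in> E) \<and>
     (\<exists>d\<in>A. d \<noteq> \<zero>\<^bsub>F\<^esub> \<and> d <#\<^bsub>F\<^esub> E \<subseteq> A)}"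

definition module_span :: "('a, 'm) ring_scheme \<Rightarrow> 'a set \<Rightarrow> 'a set \<Rightarrow> 'a set" where
  "module_span F A S = {\<Oplus>\<^bsub>F\<^esub>s\<in>S. c s \<otimes>\<^bsub>F\<^esub> s | c. c \<in> S \<rightarrow> A}"

definition fg_frac_ideals :: "('a, 'm) ring_scheme \<Rightarrow> 'a set \<Rightarrow> 'a set set" where
  "fg_frac_ideals F A =
     {E \<in> frac_ideals F A. \<exists>S. finite S \<and> S \<subseteq> quot_field F A \<and> E = module_span F A S}"

definition frac_inverse :: "('a, 'm) ring_scheme \<Rightarrow> 'a set \<Rightarrow> 'a set \<Rightarrow> 'a set" where
  "frac_inverse F A I = {x \<in> quot_field F A. \<forall>y\<in>I. x \<otimes>\<^bsub>F\<^esub> y \<in> A}"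

definition v_operation :: "('a, 'm) ring_scheme \<Rightarrow> 'a set \<Rightarrow> 'a set \<Rightarrow> 'a set" where
  "v_operation F A E = frac_inverse F A (frac_inverse F A E)"

text \<open>A star operation is a total function on sets; only its values on \<open>frac_ideals F A\<close> are
  constrained or used.\<close>

definition star_operation ::
    "('a, 'm) ring_scheme \<Rightarrow> 'a set \<Rightarrow> ('a set \<Rightarrow> 'a set) \<Rightarrow> bool" where
  "star_operation F A star \<longleftrightarrow>
     (\<forall>E\<in>frac_ideals F A. star E \<in> frac_ideals F A) \<and>
     (\<forall>x\<in>quot_field F A - {\<zero>\<^bsub>F\<^esub>}. star (x <#\<^bsub>F\<^esub> A) = x <#\<^bsub>F\<^esub> A) \<and>
     (\<forall>x\<in>quot_field F A - {\<zero>\<^bsub>F\<^esub>}. \<forall>E\<in>frac_ideals F A.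
        star (x <#\<^bsub>F\<^esub> E) = x <#\<^bsub>F\<^esub> star E) \<and>
     (\<forall>E\<in>frac_ideals F A. \<forall>E'\<in>frac_ideals F A. E \<subseteq> E' \<longrightarrow> star E \<subseteq> star E') \<and>
     (\<forall>E\<in>frac_ideals F A. E \<subseteq> star E \<and> star (star E) = star E)"

definition star_finite ::
    "('a, 'm) ring_scheme \<Rightarrow> 'a set \<Rightarrow> ('a set \<Rightarrow> 'a set) \<Rightarrow> 'a set \<Rightarrow> 'a set" where
  "star_finite F A star E = \<Union>{star I | I. I \<in> fg_frac_ideals F A \<and> I \<subseteq> E}"

text \<open>The product of fractional ideals is \<open>ideal_prod\<close>, the set of nonempty finite sums of
  products; its definition only uses the operations of \<open>F\<close> and does not require ideals of \<open>F\<close>.\<close>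

definition prufer_star_mult_domain ::
    "('a, 'm) ring_scheme \<Rightarrow> 'a set \<Rightarrow> ('a set \<Rightarrow> 'a set) \<Rightarrow> bool" where
  "prufer_star_mult_domain F A star \<longleftrightarrow>
     (\<forall>I\<in>fg_frac_ideals F A. star_finite F A star (ideal_prod F I (frac_inverse F A I)) = A)"

text \<open>The projection of \<open>star\<close> along \<open>\<phi> : T \<rightarrow> k\<close> to the subring \<open>D\<close> of \<open>k\<close>. The condition
  \<open>E \<subseteq> yD\<close> forces \<open>y \<noteq> 0\<close> because \<open>E\<close> is a nonzero fractional ideal, and then
  \<open>y\<^sup>-\<^sup>1E \<subseteq> D\<close>.\<close>

definition star_projection ::
    "'a set \<Rightarrow> ('b, 'm) ring_scheme \<Rightarrow> ('a \<Rightarrow> 'b) \<Rightarrow> 'b set \<Rightarrow> ('a set \<Rightarrow> 'a set) \<Rightarrow> 'b set \<Rightarrow> 'b set" where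
  "star_projection T k \<phi> D star E =
     \<Inter>{y <#\<^bsub>k\<^esub> (\<phi> ` star {x \<in> T. \<phi> x \<in> inv\<^bsub>k\<^esub> y <#\<^bsub>k\<^esub> E}) | y.
        y \<in> quot_field k D \<and> E \<subseteq> y <#\<^bsub>k\<^esub> D}"

definition star_extension ::
    "('a, 'm) ring_scheme \<Rightarrow> 'a set \<Rightarrow> ('a set \<Rightarrow> 'a set) \<Rightarrow> 'a set \<Rightarrow> 'a set" where
  "star_extension F T star E = star E \<inter> v_operation F T E"

definition localization_at :: "('a, 'm) ring_scheme \<Rightarrow> 'a set \<Rightarrow> 'a set \<Rightarrow> 'a set" where
  "localization_at F A P = {a \<otimes>\<^bsub>F\<^esub> inv\<^bsub>F\<^esub> s | a s. a \<in> A \<and> s \<in> A - P}"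

definition valuation_domain :: "('a, 'm) ring_scheme \<Rightarrow> 'a set \<Rightarrow> bool" where
  "valuation_domain F A \<longleftrightarrow> subdomain A F \<and>
     (\<forall>x\<in>quot_field F A - {\<zero>\<^bsub>F\<^esub>}. x \<in> A \<or> inv\<^bsub>F\<^esub> x \<in> A)"

end

theory Submission
  imports Defs
begin

text \<open>A finite set \<open>G \<subseteq> A\<close> with \<open>1 \<in> (GA)\<^sup>\<star>\<close> acts as a unit ideal for the star operation, so
  \<open>A\<close> is a P\<open>\<star>\<close>MD iff every nonzero finitely generated \<open>I\<close> admits such a \<open>G\<close> inside \<open>II\<^sup>-\<^sup>1\<close>.

  The ideal \<open>M\<close> never satisfies \<open>1 \<in> M\<^sup>\<star>\<close>, so if \<open>R\<close> is a P\<open>\<star>\<close>MD then \<open>II\<^sup>-\<^sup>1\<close> is never contained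
  in \<open>M\<close>; taking \<open>I = (1, x)\<close> shows that \<open>k\<close> is the quotient field of \<open>D\<close> and that \<open>T\<^sub>M\<close> is a
  valuation domain. A suitable \<open>G\<close> for \<open>IR\<close> serves for \<open>IT\<close>, and its image serves for the
  image of \<open>I\<close> in \<open>k\<close>, because \<open>\<phi>\<^sup>-\<^sup>1\<close> of a nonzero finitely generated \<open>D\<close>-module is finitely
  generated over \<open>R\<close>.

  Conversely, the valuation domain \<open>T\<^sub>M = R\<^sub>M\<close> lets one rescale \<open>I\<close> so that \<open>I \<subseteq> R\<close> and
  \<open>\<not> I \<subseteq> M\<close>. The hypothesis on \<open>D\<close> yields a suitable \<open>G \<subseteq> II\<^sup>-\<^sup>1 + M\<close>, that on \<open>T\<close> a suitable
  \<open>H \<subseteq> R\<close> with \<open>HM \<subseteq> II\<^sup>-\<^sup>1\<close>, and the products \<open>gh\<close> lie in \<open>II\<^sup>-\<^sup>1\<close>.\<close>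

section \<open>Submodules and spans\<close>

text \<open>Closure under additive inverses comes from multiplication by -1 once \<open>A\<close> is
  a subring. Since \<open>A\<close> is an arbitrary set of scalars, restricting scalars from
  \<open>T\<close> to \<open>R\<close> is just inclusion of sets.\<close>

definition is_submodule :: "('a, 'm) ring_scheme \<Rightarrow> 'a set \<Rightarrow> 'a set \<Rightarrow> bool" where
  "is_submodule F A E \<longleftrightarrow> E \<subseteq> carrier F \<and> \<zero>\<^bsub>F\<^esub> \<in> E \<and>
     (\<forall>x\<in>E. \<forall>y\<in>E. x \<oplus>\<^bsub>F\<^esub> y \<in> E) \<and> (\<forall>a\<in>A. \<forall>x\<in>E. a \<otimes>\<^bsub>F\<^esub> x \<in> E)"

lemma is_submoduleI:
  assumes "E \<subseteq> carrier F" "\<zero>\<^bsub>F\<^esub> \<in> E"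
    "\<And>x y. x \<in> E \<Longrightarrow> y \<in> E \<Longrightarrow> x \<oplus>\<^bsub>F\<^esub> y \<in> E"
    "\<And>a x. a \<in> A \<Longrightarrow> x \<in> E \<Longrightarrow> a \<otimes>\<^bsub>F\<^esub> x \<in> E"
  shows "is_submodule F A E"
  using assms unfolding is_submodule_def by auto

lemma is_submoduleD:
  assumes "is_submodule F A E"
  shows "E \<subseteq> carrier F" "\<zero>\<^bsub>F\<^esub> \<in> E"
    "\<And>x y. x \<in> E \<Longrightarrow> y \<in> E \<Longrightarrow> x \<oplus>\<^bsub>F\<^esub> y \<in> E"
    "\<And>a x. a \<in> A \<Longrightarrow> x \<in> E \<Longrightarrow> a \<otimes>\<^bsub>F\<^esub> x \<in> E"
  using assms unfolding is_submodule_def by auto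

lemma is_submodule_antimono: "is_submodule F B E \<Longrightarrow> A \<subseteq> B \<Longrightarrow> is_submodule F A E"
  unfolding is_submodule_def by blast

lemma ideal_prod_mono:
  assumes "I \<subseteq> I'" "J \<subseteq> J'"
  shows "ideal_prod F I J \<subseteq> ideal_prod F I' J'"
proof
  fix x assume "x \<in> ideal_prod F I J"
  then show "x \<in> ideal_prod F I' J'"
    by induction (use assms in \<open>auto intro: ideal_prod.intros\<close>)
qed

lemma ideal_prod_least:
  assumes "is_submodule F A E" "\<And>i j. i \<in> I \<Longrightarrow> j \<in> J \<Longrightarrow> i \<otimes>\<^bsub>F\<^esub> j \<in> E"
  shows "ideal_prod F I J \<subseteq> E"
proof
  fix x assume "x \<in> ideal_prod F I J"
  then show "x \<in> E"
    by induction (use assms in \<open>auto intro: is_submoduleD\<close>)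
qed

lemma (in ring) is_submodule_subring:
  assumes "subring A R"
  shows "is_submodule R A A"
  using subringE[OF assms] by (auto intro!: is_submoduleI)

lemma (in ring) is_submodule_minus:
  assumes "subring A R" "is_submodule R A E" "x \<in> E"
  shows "\<ominus> x \<in> E"
proof -
  have "\<ominus> \<one> \<in> A" using subringE(3,5)[OF assms(1)] by blast
  then have "\<ominus> \<one> \<otimes> x \<in> E" using assms(2,3) is_submoduleD(4) by metis
  moreover have "x \<in> carrier R" using assms(2,3) is_submoduleD(1) by blast
  ultimately show ?thesis by (simp add: l_minus)
qed

text \<open>Together with \<open>span_least\<close> this reduces a claim that \<open>c\<close>
  multiplies a whole span into \<open>E\<close> to a check on the generators.\<close>

lemma (in cring) is_submodule_mult_vimage:
  assumes "A \<subseteq> carrier R" "is_submodule R A E" "c \<in> carrier R"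
  shows "is_submodule R A {x \<in> carrier R. c \<otimes> x \<in> E}"
  using is_submoduleD[OF assms(2)] assms(1,3)
  by (intro is_submoduleI) (auto simp: r_distr m_lcomm subset_iff)

lemma span_memI: "c \<in> S \<rightarrow> A \<Longrightarrow> (\<Oplus>\<^bsub>F\<^esub>s\<in>S. c s \<otimes>\<^bsub>F\<^esub> s) \<in> module_span F A S"
  unfolding module_span_def by blast

lemma (in cring) is_submodule_span:
  assumes "subring A R" "finite S" "S \<subseteq> carrier R"
  shows "is_submodule R A (module_span R A S)"
proof (rule is_submoduleI)
  note A = subringE[OF assms(1)]
  have c: "(\<lambda>s. c s \<otimes> s) \<in> S \<rightarrow> carrier R" if "c \<in> S \<rightarrow> A" for c
    using that A(1) assms(3) by blast
  show "module_span R A S \<subseteq> carrier R"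
    unfolding module_span_def using c by (auto intro!: finsum_closed)
  show "\<zero> \<in> module_span R A S"
  proof -
    have "(\<Oplus>s\<in>S. \<zero> \<otimes> s) = (\<Oplus>s\<in>S. \<zero>)"
      using assms(3) by (intro finsum_cong') auto
    then show ?thesis using span_memI[of "\<lambda>_. \<zero>" S A R] A(2) by simp
  qed
  show "x \<oplus> y \<in> module_span R A S"
    if xy: "x \<in> module_span R A S" "y \<in> module_span R A S" for x y
  proof -
    obtain c d where cd: "c \<in> S \<rightarrow> A" "x = (\<Oplus>s\<in>S. c s \<otimes> s)" "d \<in> S \<rightarrow> A" "y = (\<Oplus>s\<in>S. d s \<otimes> s)"
      using xy unfolding module_span_def by auto
    have "x \<oplus> y = (\<Oplus>s\<in>S. c s \<otimes> s \<oplus> d s \<otimes> s)"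
      unfolding cd using c[OF cd(1)] c[OF cd(3)] by (simp add: finsum_addf)
    also have "\<dots> = (\<Oplus>s\<in>S. (c s \<oplus> d s) \<otimes> s)"
      using cd A(1) assms(3) by (intro finsum_cong') (auto simp: l_distr subset_iff Pi_iff)
    finally show ?thesis using span_memI[of "\<lambda>s. c s \<oplus> d s" S A R] cd A(7) by auto
  qed
  show "a \<otimes> x \<in> module_span R A S" if ax: "a \<in> A" "x \<in> module_span R A S" for a x
  proof -
    obtain c where cd: "c \<in> S \<rightarrow> A" "x = (\<Oplus>s\<in>S. c s \<otimes> s)"
      using ax unfolding module_span_def by auto
    have "a \<otimes> x = (\<Oplus>s\<in>S. a \<otimes> (c s \<otimes> s))"
      unfolding cd using c[OF cd(1)] assms(2) ax(1) A(1) by (intro finsum_rdistr) auto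
    also have "\<dots> = (\<Oplus>s\<in>S. (a \<otimes> c s) \<otimes> s)"
      using cd ax(1) A(1) assms(3) by (intro finsum_cong') (auto simp: m_assoc subset_iff Pi_iff)
    finally show ?thesis using span_memI[of "\<lambda>s. a \<otimes> c s" S A R] cd A(6) ax(1) by auto
  qed
qed

lemma (in cring) span_superset:
  assumes "subring A R" "finite S" "S \<subseteq> carrier R"
  shows "S \<subseteq> module_span R A S"
proof
  fix x assume x: "x \<in> S"
  note A = subringE[OF assms(1)]
  have "(\<Oplus>s\<in>S. (if s = x then \<one> else \<zero>) \<otimes> s) = (\<Oplus>s\<in>S. if x = s then s else \<zero>)"
    using assms(3) by (intro finsum_cong') auto
  also have "\<dots> = x" using x assms(2,3) by (intro finsum_singleton) auto
  finally show "x \<in> module_span R A S"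
    using span_memI[of "\<lambda>s. if s = x then \<one> else \<zero>" S A R] A(2,3) by simp
qed

lemma (in cring) span_least:
  assumes "is_submodule R A E" "finite S" "S \<subseteq> E"
  shows "module_span R A S \<subseteq> E"
proof
  note E = is_submoduleD[OF assms(1)]
  fix x assume "x \<in> module_span R A S"
  then obtain c where c: "c \<in> S \<rightarrow> A" "x = (\<Oplus>s\<in>S. c s \<otimes> s)" unfolding module_span_def by auto
  \<comment> \<open>The coefficient function \<open>c\<close> stays fixed while the index set grows
    through subsets of \<open>S\<close>.\<close>
  have "(\<Oplus>s\<in>S'. c s \<otimes> s) \<in> E" if "S' \<subseteq> S" for S'
    using finite_subset[OF that assms(2)] that
  proof (induction S' rule: finite_induct)
    case empty
    then show ?case using E(2) by simp
  next
    case (insert s S')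
    have m: "c t \<otimes> t \<in> E" if "t \<in> insert s S'" for t
      using E(4) c(1) assms(3) insert.prems that by blast
    have "(\<Oplus>s\<in>insert s S'. c s \<otimes> s) = c s \<otimes> s \<oplus> (\<Oplus>s\<in>S'. c s \<otimes> s)"
      using insert.hyps m E(1) by (intro finsum_insert) auto
    then show ?case using insert m E(3) by simp
  qed
  then show "x \<in> E" using c(2) by simp
qed

lemma (in cring) span_mono:
  assumes "subring A R" "subring B R" "A \<subseteq> B" "finite S" "finite S'" "S' \<subseteq> carrier R" "S \<subseteq> S'"
  shows "module_span R A S \<subseteq> module_span R B S'"
  using assms span_superset[of B S'] is_submodule_span[of B S'] is_submodule_antimono
  by (intro span_least) blast+

lemma (in ring) add_minus_cancel:
  "x \<in> carrier R \<Longrightarrow> y \<in> carrier R \<Longrightarrow> x \<oplus> (y \<ominus> x) = y"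
  unfolding minus_eq by (subst a_lcomm) (simp_all add: r_neg)

lemma (in field) inv_simps:
  assumes "x \<in> carrier R" "x \<noteq> \<zero>"
  shows "inv x \<in> carrier R" "inv x \<noteq> \<zero>" "x \<otimes> inv x = \<one>" "inv x \<otimes> x = \<one>"
proof -
  have x: "x \<in> Units R" using assms field_Units by auto
  then show "inv x \<in> carrier R" "x \<otimes> inv x = \<one>" "inv x \<otimes> x = \<one>" by auto
  then show "inv x \<noteq> \<zero>" using assms by auto
qed

section \<open>Fractional ideals of a subring with full quotient field\<close>

text \<open>The ambient field is the quotient field of \<open>A\<close>, so every side condition
  about \<open>quot_field\<close> becomes membership in the carrier. \<open>T\<close> and
  \<open>R\<close> always fit this setting; \<open>D\<close> fits only once \<open>k\<close> is
  known to be its quotient field.\<close>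

locale quot_subring = field F for F (structure) +
  fixes A
  assumes subring: "subring A F" and quot_field: "quot_field F A = carrier F"
begin

lemmas A_simps = subringE(2,3,5-7)[OF subring]

lemma A_sub: "A \<subseteq> carrier F"
  using subringE(1)[OF subring] .

lemma A_carrier [simp, intro]: "a \<in> A \<Longrightarrow> a \<in> carrier F"
  using A_sub by auto

lemma common_denominator:
  assumes "finite S" "S \<subseteq> carrier F"
  shows "\<exists>d\<in>A. d \<noteq> \<zero> \<and> (\<forall>s\<in>S. d \<otimes> s \<in> A)"
  using assms
proof (induction S rule: finite_induct)
  case empty
  show ?case using A_simps(2) one_not_zero by blast
next
  case (insert x S)
  then obtain d where d: "d \<in> A" "d \<noteq> \<zero>" "\<And>s. s \<in> S \<Longrightarrow> d \<otimes> s \<in> A" by auto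
  obtain a b where ab: "x = a \<otimes> inv b" "a \<in> A" "b \<in> A" "b \<noteq> \<zero>"
    using insert.prems quot_field unfolding quot_field_def by blast
  note b = inv_simps[OF _ ab(4)]
  have "b \<otimes> d \<otimes> x = d \<otimes> (a \<otimes> (b \<otimes> inv b))"
    unfolding ab(1) using ab(2,3) d(1) b(1) by (simp add: m_ac)
  then have "b \<otimes> d \<otimes> x \<in> A" using ab d b A_simps(4) by simp
  moreover have "b \<otimes> d \<otimes> s \<in> A" if "s \<in> S" for s
  proof -
    have "b \<otimes> d \<otimes> s = b \<otimes> (d \<otimes> s)" using ab d insert.prems that by (intro m_assoc) auto
    then show ?thesis using ab d A_simps(4) that by simp
  qed
  moreover have "b \<otimes> d \<in> A" "b \<otimes> d \<noteq> \<zero>" using ab d A_simps(4) integral_iff by auto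
  ultimately show ?case by (intro bexI[of _ "b \<otimes> d"]) auto
qed

lemma frac_ideals_iff:
  "E \<in> frac_ideals F A \<longleftrightarrow>
     is_submodule F A E \<and> E \<noteq> {\<zero>} \<and> (\<exists>d\<in>A. d \<noteq> \<zero> \<and> (\<forall>x\<in>E. d \<otimes> x \<in> A))"
proof -
  have 1: "additive_subgroup E F \<and> E \<subseteq> carrier F \<and> (\<forall>a\<in>A. \<forall>x\<in>E. a \<otimes> x \<in> E) \<longleftrightarrow>
    is_submodule F A E"
  proof
    assume *: "additive_subgroup E F \<and> E \<subseteq> carrier F \<and> (\<forall>a\<in>A. \<forall>x\<in>E. a \<otimes> x \<in> E)"
    then interpret additive_subgroup E F by simp
    show "is_submodule F A E" using * by (intro is_submoduleI) auto
  next
    assume *: "is_submodule F A E"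
    note E = is_submoduleD[OF *]
    have "subgroup E (add_monoid F)"
      using E is_submodule_minus[OF subring *]
      by (intro add.subgroupI) (auto simp: a_inv_def)
    then show "additive_subgroup E F \<and> E \<subseteq> carrier F \<and> (\<forall>a\<in>A. \<forall>x\<in>E. a \<otimes> x \<in> E)"
      using E by (auto intro: additive_subgroup.intro)
  qed
  have 2: "d <# E \<subseteq> A \<longleftrightarrow> (\<forall>x\<in>E. d \<otimes> x \<in> A)" for d
    unfolding l_coset_def by auto
  show ?thesis
    unfolding frac_ideals_def quot_field mem_Collect_eq 2 using 1 by argo
qed

lemma integral_frac_ideal:
  assumes "is_submodule F A E" "E \<subseteq> A" "x \<in> E" "x \<noteq> \<zero>"
  shows "E \<in> frac_ideals F A"
  unfolding frac_ideals_iff using assms A_simps(2) one_not_zero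
  by (intro conjI bexI[of _ \<one>]) (auto dest: is_submoduleD(1))

lemma span_frac_ideal:
  assumes "finite S" "S \<subseteq> carrier F" "\<not> S \<subseteq> {\<zero>}"
  shows "module_span F A S \<in> frac_ideals F A"
proof -
  obtain d where d: "d \<in> A" "d \<noteq> \<zero>" "\<And>s. s \<in> S \<Longrightarrow> d \<otimes> s \<in> A"
    using common_denominator[OF assms(1,2)] by auto
  have "is_submodule F A {x \<in> carrier F. d \<otimes> x \<in> A}"
    using d by (intro is_submodule_mult_vimage A_sub is_submodule_subring subring) auto
  then have "module_span F A S \<subseteq> {x \<in> carrier F. d \<otimes> x \<in> A}"
    using assms d by (intro span_least) auto
  then show ?thesis
    unfolding frac_ideals_iff using d span_superset[OF subring] is_submodule_span[OF subring] assms
    by blast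
qed

lemma span_fg_frac_ideal:
  assumes "finite S" "S \<subseteq> carrier F" "\<not> S \<subseteq> {\<zero>}"
  shows "module_span F A S \<in> fg_frac_ideals F A"
  unfolding fg_frac_ideals_def using span_frac_ideal[OF assms] assms quot_field by auto

lemma fg_frac_idealE:
  assumes "I \<in> fg_frac_ideals F A"
  obtains S where "finite S" "S \<subseteq> carrier F" "\<not> S \<subseteq> {\<zero>}" "I = module_span F A S"
proof -
  obtain S where S: "finite S" "S \<subseteq> carrier F" "I = module_span F A S"
    using assms quot_field unfolding fg_frac_ideals_def by auto
  moreover have "\<not> S \<subseteq> {\<zero>}"
  proof
    assume "S \<subseteq> {\<zero>}"
    moreover have "is_submodule F A {\<zero>}" by (rule is_submoduleI) auto
    ultimately have "I \<subseteq> {\<zero>}" using S span_least by metis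
    moreover have "is_submodule F A I" "I \<noteq> {\<zero>}"
      using assms unfolding fg_frac_ideals_def frac_ideals_iff by auto
    ultimately show False using is_submoduleD(2) by blast
  qed
  ultimately show ?thesis using that by blast
qed

section \<open>The inverse of a finitely generated module and its product with the module\<close>

lemma frac_inverse_span:
  assumes "finite S" "S \<subseteq> carrier F"
  shows "frac_inverse F A (module_span F A S) = {x \<in> carrier F. \<forall>s\<in>S. x \<otimes> s \<in> A}"
proof -
  have "x \<otimes> y \<in> A"
    if x: "x \<in> carrier F" "\<forall>s\<in>S. x \<otimes> s \<in> A" and y: "y \<in> module_span F A S" for x y
  proof -
    have "is_submodule F A {y \<in> carrier F. x \<otimes> y \<in> A}"
      using x by (intro is_submodule_mult_vimage A_sub is_submodule_subring subring) auto
    then have "module_span F A S \<subseteq> {y \<in> carrier F. x \<otimes> y \<in> A}"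
      using assms x by (intro span_least) auto
    then show ?thesis using y by auto
  qed
  then show ?thesis
    unfolding frac_inverse_def quot_field using span_superset[OF subring assms] by blast
qed

text \<open>The second factor is the inverse of the span, tested on the generators alone;
  \<open>inv_prod_eq\<close> identifies the result with the product in the definition of a Pruefer
  domain.\<close>

definition inv_prod :: "'a set \<Rightarrow> 'a set" where
  "inv_prod S = ideal_prod F (module_span F A S) {x \<in> carrier F. \<forall>s\<in>S. x \<otimes> s \<in> A}"

lemma inv_prod_eq:
  assumes "finite S" "S \<subseteq> carrier F"
  shows "ideal_prod F (module_span F A S) (frac_inverse F A (module_span F A S)) = inv_prod S"
  unfolding inv_prod_def frac_inverse_span[OF assms] ..

lemma inv_prod_subset:
  assumes "finite S" "S \<subseteq> carrier F"
  shows "inv_prod S \<subseteq> A"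
  unfolding inv_prod_def frac_inverse_span[OF assms, symmetric]
proof (rule ideal_prod_least[OF is_submodule_subring[OF subring]])
  fix i j assume ij: "i \<in> module_span F A S" "j \<in> frac_inverse F A (module_span F A S)"
  have "i \<in> carrier F" using ij is_submodule_span[OF subring assms] is_submoduleD(1) by blast
  moreover have "j \<in> carrier F" using ij unfolding frac_inverse_def quot_field by auto
  ultimately show "i \<otimes> j \<in> A" using ij m_comm unfolding frac_inverse_def by auto
qed

lemma inv_prod_memI:
  assumes "finite S" "S \<subseteq> carrier F" "s \<in> S" "x \<in> carrier F" "\<And>t. t \<in> S \<Longrightarrow> x \<otimes> t \<in> A"
  shows "s \<otimes> x \<in> inv_prod S"
  unfolding inv_prod_def using span_superset[OF subring assms(1,2)] assms
  by (intro ideal_prod.prod) auto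

lemma is_submodule_inv_prod:
  assumes "finite S" "S \<subseteq> carrier F"
  shows "is_submodule F A (inv_prod S)"
proof (rule is_submoduleI)
  note sp = is_submodule_span[OF subring assms]
  let ?J = "{x \<in> carrier F. \<forall>s\<in>S. x \<otimes> s \<in> A}"
  show "inv_prod S \<subseteq> carrier F" using inv_prod_subset[OF assms] A_sub by blast
  have "\<zero> \<otimes> \<zero> \<in> inv_prod S"
    unfolding inv_prod_def using is_submoduleD(2)[OF sp] A_simps(1) assms
    by (intro ideal_prod.prod) auto
  then show "\<zero> \<in> inv_prod S" by simp
  show "x \<oplus> y \<in> inv_prod S" if "x \<in> inv_prod S" "y \<in> inv_prod S" for x y
    using that unfolding inv_prod_def by (rule ideal_prod.sum)
  show "a \<otimes> x \<in> inv_prod S" if a: "a \<in> A" and "x \<in> inv_prod S" for a x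
    using that(2) unfolding inv_prod_def
  proof (induction rule: ideal_prod.induct)
    case (prod i j)
    have "i \<in> carrier F" using prod is_submoduleD(1)[OF sp] by auto
    then have "a \<otimes> (i \<otimes> j) = (a \<otimes> i) \<otimes> j" using a prod by (simp add: m_assoc)
    then show ?case using is_submoduleD(4)[OF sp a] prod by (simp add: ideal_prod.prod)
  next
    case (sum s t)
    have "s \<in> carrier F" "t \<in> carrier F"
      using sum.hyps inv_prod_subset[OF assms] unfolding inv_prod_def by auto
    then show ?case using sum a by (simp add: r_distr ideal_prod.sum)
  qed
qed

text \<open>Scaling a module by \<open>c\<close> scales its inverse by the inverse of
  \<open>c\<close>, and the two factors cancel in the product. A set \<open>G\<close> found for a
  rescaled module therefore serves for the original one.\<close>

lemma inv_prod_scale: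
  assumes "finite S" "S \<subseteq> carrier F" "c \<in> carrier F" "c \<noteq> \<zero>"
  shows "inv_prod ((\<otimes>) c ` S) \<subseteq> inv_prod S"
proof -
  let ?S = "(\<otimes>) c ` S"
  note c = inv_simps[OF assms(3,4)]
  note sp = is_submodule_span[OF subring assms(1,2)]
  have S': "finite ?S" "?S \<subseteq> carrier F" using assms by auto
  have "is_submodule F A {x \<in> carrier F. inv c \<otimes> x \<in> module_span F A S}"
    using c by (intro is_submodule_mult_vimage A_sub sp)
  moreover have "?S \<subseteq> {x \<in> carrier F. inv c \<otimes> x \<in> module_span F A S}"
    using span_superset[OF subring assms(1,2)] c assms
    by (auto simp: m_assoc[symmetric] subset_iff)
  ultimately have 1: "module_span F A ?S \<subseteq> {x \<in> carrier F. inv c \<otimes> x \<in> module_span F A S}"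
    using span_least S'(1) by metis
  show ?thesis
    unfolding inv_prod_def[of ?S]
  proof (rule ideal_prod_least[OF is_submodule_inv_prod[OF assms(1,2)]])
    fix i j assume ij: "i \<in> module_span F A ?S" "j \<in> {x \<in> carrier F. \<forall>s\<in>?S. x \<otimes> s \<in> A}"
    have i: "i \<in> carrier F" "inv c \<otimes> i \<in> module_span F A S" using 1 ij by auto
    have j: "j \<in> carrier F" using ij by auto
    have "c \<otimes> j \<otimes> s = j \<otimes> (c \<otimes> s)" if "s \<in> S" for s
      using that assms ij by (auto simp: m_ac subset_iff)
    then have "c \<otimes> j \<in> {x \<in> carrier F. \<forall>s\<in>S. x \<otimes> s \<in> A}"
      using ij assms by auto
    then have "(inv c \<otimes> i) \<otimes> (c \<otimes> j) \<in> inv_prod S"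
      unfolding inv_prod_def using i by (intro ideal_prod.prod) auto
    moreover have "(inv c \<otimes> i) \<otimes> (c \<otimes> j) = (c \<otimes> inv c) \<otimes> (i \<otimes> j)"
      using i(1) j c(1) assms(3) by (simp add: m_ac)
    ultimately show "i \<otimes> j \<in> inv_prod S" using c(3) i(1) j by simp
  qed
qed

text \<open>The hypothesis on \<open>star\<close> is weaker than being a star operation, so the
  criterion also covers the projection and the extension directly. It reduces equality with
  \<open>A\<close> to membership of \<open>\<one>\<close>, and \<open>\<one>\<close> lies in the
  union \<open>star_finite\<close> as soon as it lies in \<open>star I\<close> for a single finitely
  generated \<open>I\<close>; generators of that \<open>I\<close> form \<open>G\<close>.\<close>

lemma prufer_iff:
  assumes star: "\<And>J. J \<in> fg_frac_ideals F A \<Longrightarrow> J \<subseteq> A \<Longrightarrow> star J \<subseteq> A \<and> (\<one> \<in> star J \<longrightarrow> A \<subseteq> star J)"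
  shows "prufer_star_mult_domain F A star \<longleftrightarrow>
    (\<forall>S. finite S \<longrightarrow> S \<subseteq> carrier F \<longrightarrow> \<not> S \<subseteq> {\<zero>} \<longrightarrow>
      (\<exists>G. finite G \<and> G \<subseteq> inv_prod S \<and> \<not> G \<subseteq> {\<zero>} \<and> \<one> \<in> star (module_span F A G)))"
    (is "_ \<longleftrightarrow> (\<forall>S. ?fin S \<longrightarrow> ?sub S \<longrightarrow> ?nz S \<longrightarrow> ?P S)")
proof -
  have *: "star_finite F A star (inv_prod S) = A \<longleftrightarrow> ?P S"
    if S: "finite S" "S \<subseteq> carrier F" for S
  proof
    assume "star_finite F A star (inv_prod S) = A"
    then have "\<one> \<in> star_finite F A star (inv_prod S)" using A_simps(2) by simp
    then obtain I where I: "I \<in> fg_frac_ideals F A" "I \<subseteq> inv_prod S" "\<one> \<in> star I"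
      unfolding star_finite_def by auto
    obtain G where "finite G" "G \<subseteq> carrier F" "\<not> G \<subseteq> {\<zero>}" "I = module_span F A G"
      using I(1) by (rule fg_frac_idealE)
    then show "?P S" using I span_superset[OF subring, of G] by blast
  next
    assume "?P S"
    then obtain G where G: "finite G" "G \<subseteq> inv_prod S" "\<not> G \<subseteq> {\<zero>}" "\<one> \<in> star (module_span F A G)"
      by blast
    have GA: "G \<subseteq> carrier F" using G(2) inv_prod_subset[OF S] A_sub by blast
    have "module_span F A G \<subseteq> inv_prod S"
      using span_least[OF is_submodule_inv_prod[OF S]] G by blast
    moreover have fg: "module_span F A G \<in> fg_frac_ideals F A" using span_fg_frac_ideal G GA by blast
    ultimately have "star (module_span F A G) \<subseteq> star_finite F A star (inv_prod S)"
      and "A \<subseteq> star (module_span F A G)"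
      using star[OF fg] G(4) inv_prod_subset[OF S] unfolding star_finite_def by blast+
    moreover have "star_finite F A star (inv_prod S) \<subseteq> A"
      using star inv_prod_subset[OF S] unfolding star_finite_def by blast
    ultimately show "star_finite F A star (inv_prod S) = A" by blast
  qed
  show ?thesis
  proof
    assume P: "prufer_star_mult_domain F A star"
    show "\<forall>S. ?fin S \<longrightarrow> ?sub S \<longrightarrow> ?nz S \<longrightarrow> ?P S"
      using P span_fg_frac_ideal * inv_prod_eq unfolding prufer_star_mult_domain_def by metis
  next
    assume P: "\<forall>S. ?fin S \<longrightarrow> ?sub S \<longrightarrow> ?nz S \<longrightarrow> ?P S"
    show "prufer_star_mult_domain F A star"
      unfolding prufer_star_mult_domain_def
    proof
      fix I assume "I \<in> fg_frac_ideals F A"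
      then obtain S where "finite S" "S \<subseteq> carrier F" "\<not> S \<subseteq> {\<zero>}" "I = module_span F A S"
        by (rule fg_frac_idealE)
      then show "star_finite F A star (ideal_prod F I (frac_inverse F A I)) = A"
        using P * inv_prod_eq by metis
    qed
  qed
qed

lemma frac_ideal_subset:
  assumes "E' \<in> frac_ideals F A" "is_submodule F A E" "E \<subseteq> E'" "x \<in> E" "x \<noteq> \<zero>"
  shows "E \<in> frac_ideals F A"
  using assms unfolding frac_ideals_iff by blast

end

section \<open>Star operations\<close>

locale star_domain = quot_subring +
  fixes star
  assumes star_op: "star_operation F A star"
begin

lemma star_frac: "E \<in> frac_ideals F A \<Longrightarrow> star E \<in> frac_ideals F A"
  using star_op unfolding star_operation_def by auto

lemma star_mono:
  "E \<in> frac_ideals F A \<Longrightarrow> E' \<in> frac_ideals F A \<Longrightarrow> E \<subseteq> E' \<Longrightarrow> star E \<subseteq> star E'"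
  using star_op unfolding star_operation_def by auto

lemma star_extensive: "E \<in> frac_ideals F A \<Longrightarrow> E \<subseteq> star E"
  using star_op unfolding star_operation_def by auto

text \<open>Monotonicity followed by idempotence, as for any closure operator.\<close>

lemma star_least:
  assumes "E \<in> frac_ideals F A" "E' \<in> frac_ideals F A" "E \<subseteq> star E'"
  shows "star E \<subseteq> star E'"
  using star_mono[OF assms(1) star_frac[OF assms(2)] assms(3)] star_op assms(2)
  unfolding star_operation_def by auto

lemma is_submodule_star: "E \<in> frac_ideals F A \<Longrightarrow> is_submodule F A (star E)"
  using star_frac frac_ideals_iff by blast

lemma A_frac_ideal: "A \<in> frac_ideals F A"
  using integral_frac_ideal[OF is_submodule_subring[OF subring]] A_simps(2) one_not_zero by blast

lemma star_A: "star A = A"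
proof -
  have "\<one> <# A = A" unfolding l_coset_def using A_sub by (auto simp: subset_iff)
  moreover have "star (\<one> <# A) = \<one> <# A"
    using star_op quot_field unfolding star_operation_def by simp
  ultimately show ?thesis by simp
qed

lemma star_subset_A: "E \<in> frac_ideals F A \<Longrightarrow> E \<subseteq> A \<Longrightarrow> star E \<subseteq> A"
  using star_mono[OF _ A_frac_ideal] star_A by simp

text \<open>For nonzero \<open>x\<close> this is the scaling axiom followed by monotonicity;
  \<open>x = \<zero>\<close>, which the axiom excludes, is trivial. It is mostly applied with
  \<open>y = \<one>\<close>, so that an inclusion of \<open>xE\<close> in \<open>E'\<close> puts
  \<open>x\<close> itself into \<open>star E'\<close>.\<close>

lemma star_scale:
  assumes "E \<in> frac_ideals F A" "E' \<in> frac_ideals F A" "x \<in> carrier F"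
    "\<And>e. e \<in> E \<Longrightarrow> x \<otimes> e \<in> E'" "y \<in> star E"
  shows "x \<otimes> y \<in> star E'"
proof (cases "x = \<zero>")
  case True
  have "y \<in> carrier F" using is_submoduleD(1)[OF is_submodule_star[OF assms(1)]] assms(5) by auto
  then show ?thesis using True is_submoduleD(2)[OF is_submodule_star[OF assms(2)]] by simp
next
  case False
  have E: "is_submodule F A E" "E \<noteq> {\<zero>}" using assms(1) unfolding frac_ideals_iff by auto
  note E1 = is_submoduleD[OF E(1)]
  have sub: "is_submodule F A (x <# E)"
  proof (rule is_submoduleI)
    show "x <# E \<subseteq> carrier F" unfolding l_coset_def using E1(1) assms(3) by auto
    have "x \<otimes> \<zero> \<in> x <# E" unfolding l_coset_def using E1(2) by blast
    then show "\<zero> \<in> x <# E" using assms(3) by simp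
  next
    fix a b assume "a \<in> x <# E" "b \<in> x <# E"
    then obtain a' b' where ab: "a' \<in> E" "b' \<in> E" "a = x \<otimes> a'" "b = x \<otimes> b'"
      unfolding l_coset_def by auto
    then have "a \<oplus> b = x \<otimes> (a' \<oplus> b')" using E1(1) assms(3) by (auto simp: r_distr subset_iff)
    then show "a \<oplus> b \<in> x <# E" unfolding l_coset_def using E1(3) ab by blast
  next
    fix a b assume a: "a \<in> A" and "b \<in> x <# E"
    then obtain b' where ab: "b' \<in> E" "b = x \<otimes> b'" unfolding l_coset_def by auto
    then have "a \<otimes> b = x \<otimes> (a \<otimes> b')"
      using E1(1) assms(3) a by (auto simp: m_lcomm subset_iff)
    then show "a \<otimes> b \<in> x <# E" unfolding l_coset_def using E1(4) ab a by blast
  qed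
  have subs: "x <# E \<subseteq> E'" unfolding l_coset_def using assms(4) by auto
  obtain e where e: "e \<in> E" "e \<noteq> \<zero>" using E E1(2) by auto
  then have "x \<otimes> e \<in> x <# E" "x \<otimes> e \<noteq> \<zero>"
    using False assms(3) E1(1) integral_iff unfolding l_coset_def by auto
  then have "x <# E \<in> frac_ideals F A" using frac_ideal_subset[OF assms(2) sub subs] by blast
  then have "star (x <# E) \<subseteq> star E'" using star_mono assms(2) subs by blast
  moreover have "star (x <# E) = x <# star E"
    using star_op quot_field assms(1,3) False unfolding star_operation_def by auto
  ultimately show ?thesis using assms(5) unfolding l_coset_def by blast
qed

lemma prufer_star_iff:
  "prufer_star_mult_domain F A star \<longleftrightarrow>
    (\<forall>S. finite S \<longrightarrow> S \<subseteq> carrier F \<longrightarrow> \<not> S \<subseteq> {\<zero>} \<longrightarrow>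
      (\<exists>G. finite G \<and> G \<subseteq> inv_prod S \<and> \<not> G \<subseteq> {\<zero>} \<and> \<one> \<in> star (module_span F A G)))"
proof (rule prufer_iff)
  fix J assume J: "J \<in> fg_frac_ideals F A" "J \<subseteq> A"
  then have J': "J \<in> frac_ideals F A" unfolding fg_frac_ideals_def by auto
  have "A \<subseteq> star J" if "\<one> \<in> star J"
    using is_submoduleD(4)[OF is_submodule_star[OF J'] _ that] by fastforce
  then show "star J \<subseteq> A \<and> (\<one> \<in> star J \<longrightarrow> A \<subseteq> star J)"
    using star_subset_A[OF J' J(2)] by blast
qed

text \<open>Each \<open>g\<close> in \<open>G\<close> multiplies \<open>H\<close> into the span of
  \<open>P\<close>, so scaling \<open>\<one> \<in> star (module_span F A H)\<close> by
  \<open>g\<close> puts \<open>g\<close> into the closure of that span. Hence the closure of the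
  span of \<open>G\<close>, which contains \<open>\<one>\<close>, lies there too.\<close>

lemma one_in_star_span_times:
  assumes G: "finite G" "G \<subseteq> carrier F" "\<not> G \<subseteq> {\<zero>}" "\<one> \<in> star (module_span F A G)"
    and H: "finite H" "H \<subseteq> carrier F" "\<not> H \<subseteq> {\<zero>}" "\<one> \<in> star (module_span F A H)"
    and P: "P = (\<lambda>(g, h). g \<otimes> h) ` (G \<times> H)"
  shows "finite P" "P \<subseteq> carrier F" "\<not> P \<subseteq> {\<zero>}" "\<one> \<in> star (module_span F A P)"
proof -
  show P1: "finite P" "P \<subseteq> carrier F" using assms by auto
  obtain g h where "g \<in> G" "g \<noteq> \<zero>" "h \<in> H" "h \<noteq> \<zero>" using G(3) H(3) by auto
  then have "g \<otimes> h \<in> P" "g \<otimes> h \<noteq> \<zero>" using P G(2) H(2) integral_iff by auto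
  then show P2: "\<not> P \<subseteq> {\<zero>}" by auto
  note f = span_frac_ideal[OF G(1-3)] span_frac_ideal[OF H(1-3)] span_frac_ideal[OF P1 P2]
  have "G \<subseteq> star (module_span F A P)"
  proof
    fix g assume g: "g \<in> G"
    then have gc: "g \<in> carrier F" using G by auto
    have sp: "is_submodule F A (module_span F A P)" using is_submodule_span[OF subring P1] .
    have "is_submodule F A {x \<in> carrier F. g \<otimes> x \<in> module_span F A P}"
      using gc by (intro is_submodule_mult_vimage A_sub sp)
    moreover have "H \<subseteq> {x \<in> carrier F. g \<otimes> x \<in> module_span F A P}"
      using span_superset[OF subring P1] g H(2) P by auto
    ultimately have "module_span F A H \<subseteq> {x \<in> carrier F. g \<otimes> x \<in> module_span F A P}"
      using H(1) by (intro span_least)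
    then have "g \<otimes> \<one> \<in> star (module_span F A P)"
      by (intro star_scale[OF f(2,3) gc _ H(4)]) auto
    then show "g \<in> star (module_span F A P)" using gc by simp
  qed
  then have "module_span F A G \<subseteq> star (module_span F A P)"
    using is_submodule_star[OF f(3)] G(1) by (intro span_least)
  then show "\<one> \<in> star (module_span F A P)" using star_least[OF f(1,3)] G(4) by blast
qed

end

section \<open>Pullbacks along the residue map\<close>

text \<open>The residue map is abstracted to a surjective homomorphism from \<open>T\<close> onto a
  field with kernel \<open>M\<close>; this encodes maximality of \<open>M\<close> and keeps cosets
  out of the argument. The equations for \<open>\<phi>\<close> are restricted to \<open>T\<close>,
  since \<open>\<phi>\<close> is a total function on a larger type.\<close>

locale pullback = field K + k: field k for K (structure) and k (structure) +
  fixes \<phi> T M D R star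
  assumes subring_T: "subring T K" and quot_T: "quot_field K T = carrier K"
    and phi_carrier [simp]: "\<And>x. x \<in> T \<Longrightarrow> \<phi> x \<in> carrier k"
    and phi_add [simp]: "\<And>x y. x \<in> T \<Longrightarrow> y \<in> T \<Longrightarrow> \<phi> (x \<oplus> y) = \<phi> x \<oplus>\<^bsub>k\<^esub> \<phi> y"
    and phi_mult [simp]: "\<And>x y. x \<in> T \<Longrightarrow> y \<in> T \<Longrightarrow> \<phi> (x \<otimes> y) = \<phi> x \<otimes>\<^bsub>k\<^esub> \<phi> y"
    and phi_one [simp]: "\<phi> \<one> = \<one>\<^bsub>k\<^esub>"
    and phi_surj: "\<And>z. z \<in> carrier k \<Longrightarrow> \<exists>x\<in>T. \<phi> x = z"
    and M_eq: "M = {x \<in> T. \<phi> x = \<zero>\<^bsub>k\<^esub>}" and M_nonzero: "M \<noteq> {\<zero>}"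
    and subring_D: "subring D k" and D_proper: "D \<subset> carrier k"
    and R_eq: "R = {x \<in> T. \<phi> x \<in> D}"
    and star_R: "star_operation K R star"
begin

sublocale T: quot_subring K T
  by (intro quot_subring.intro quot_subring_axioms.intro field_axioms subring_T quot_T)

lemmas D_simps = subringE(2,3,5-7)[OF subring_D]

lemma D_carrier [simp, intro]: "d \<in> D \<Longrightarrow> d \<in> carrier k"
  using D_proper by auto

lemmas T_simps [simp] = T.A_simps

lemma phi_zero [simp]: "\<phi> \<zero> = \<zero>\<^bsub>k\<^esub>"
proof -
  have "\<phi> \<zero> \<oplus>\<^bsub>k\<^esub> \<phi> \<zero> = \<phi> \<zero>" using phi_add[of \<zero> \<zero>] T_simps(1) by simp
  then show ?thesis using k.add.l_cancel_one' T_simps(1) phi_carrier by metis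
qed

lemma phi_minus [simp]: "x \<in> T \<Longrightarrow> \<phi> (\<ominus> x) = \<ominus>\<^bsub>k\<^esub> \<phi> x"
proof -
  assume x: "x \<in> T"
  have "\<phi> (\<ominus> x) \<oplus>\<^bsub>k\<^esub> \<phi> x = \<zero>\<^bsub>k\<^esub>" using phi_add[of "\<ominus> x" x] x by (simp add: l_neg)
  then show ?thesis using k.minus_equality x by simp
qed

lemma M_iff: "x \<in> M \<longleftrightarrow> x \<in> T \<and> \<phi> x = \<zero>\<^bsub>k\<^esub>"
  unfolding M_eq by simp

lemma R_iff: "x \<in> R \<longleftrightarrow> x \<in> T \<and> \<phi> x \<in> D"
  unfolding R_eq by simp

lemma M_mult: "t \<in> T \<Longrightarrow> x \<in> M \<Longrightarrow> t \<otimes> x \<in> M" "t \<in> T \<Longrightarrow> x \<in> M \<Longrightarrow> x \<otimes> t \<in> M"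
  unfolding M_iff by simp_all

lemma is_submodule_M: "is_submodule K T M"
  using M_mult by (intro is_submoduleI) (auto simp: M_iff)

lemma subring_R: "subring R K"
  using D_simps by (intro subringI) (auto simp: R_iff)

lemma M_T [simp, intro]: "x \<in> M \<Longrightarrow> x \<in> T"
  by (simp add: M_iff)

lemma R_T [simp, intro]: "x \<in> R \<Longrightarrow> x \<in> T"
  by (simp add: R_iff)

lemma M_R [simp, intro]: "x \<in> M \<Longrightarrow> x \<in> R"
  unfolding M_iff R_iff using D_simps(1) by simp

lemma M_elt: obtains m where "m \<in> M" "m \<noteq> \<zero>"
  using M_nonzero is_submoduleD(2)[OF is_submodule_M] by auto

sublocale R: star_domain K R star
proof (intro star_domain.intro quot_subring.intro quot_subring_axioms.intro
    star_domain_axioms.intro field_axioms subring_R star_R)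
  have "x \<in> quot_field K R" if x: "x \<in> carrier K" for x
  proof -
    obtain a b where ab: "x = a \<otimes> inv b" "a \<in> T" "b \<in> T" "b \<noteq> \<zero>"
      using x quot_T unfolding quot_field_def by blast
    \<comment> \<open>Multiplying numerator and denominator by a nonzero element of \<open>M\<close>
      moves both into \<open>M\<close>, hence into \<open>R\<close>.\<close>
    obtain m where m: "m \<in> M" "m \<noteq> \<zero>" by (rule M_elt)
    have bm: "b \<otimes> m \<noteq> \<zero>" using ab m integral_iff by auto
    note i = inv_simps[OF _ bm] inv_simps[OF _ ab(4)]
    have "x = x \<otimes> ((b \<otimes> m) \<otimes> inv (b \<otimes> m))" using i ab m x by simp
    also have "\<dots> = (a \<otimes> m) \<otimes> inv (b \<otimes> m) \<otimes> (b \<otimes> inv b)"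
      unfolding ab(1) using i(1,5) ab(2,3) m by (simp add: m_ac)
    also have "\<dots> = (a \<otimes> m) \<otimes> inv (b \<otimes> m)" using i ab m by simp
    finally show ?thesis
      unfolding quot_field_def using ab m bm M_mult by blast
  qed
  moreover have "x \<in> carrier K" if "x \<in> quot_field K R" for x
    using that inv_simps unfolding quot_field_def by auto
  ultimately show "quot_field K R = carrier K" by blast
qed

lemmas R_simps [simp] = R.A_simps

lemma phi_diff_M:
  assumes "x \<in> T" "y \<in> T" "\<phi> x = \<phi> y"
  shows "x \<ominus> y \<in> M"
  using assms by (simp add: M_iff a_minus_def k.r_neg del: M_T)

text \<open>Comaximality of \<open>x\<close> and \<open>M\<close>: lift the inverse of the residue
  of \<open>x\<close> to \<open>u\<close>. The relation is used later to split an element into a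
  multiple of \<open>x\<close> and a part carrying a factor from \<open>M\<close>.\<close>

lemma inverse_mod_M:
  assumes "x \<in> T" "x \<notin> M"
  obtains u m where "u \<in> T" "m \<in> M" "u \<otimes> x \<oplus> m = \<one>"
proof -
  have "\<phi> x \<noteq> \<zero>\<^bsub>k\<^esub>" using assms M_iff by blast
  note i = k.inv_simps[OF phi_carrier[OF assms(1)] this]
  obtain u where u: "u \<in> T" "\<phi> u = inv\<^bsub>k\<^esub> \<phi> x" using phi_surj i(1) by blast
  have "\<one> \<ominus> u \<otimes> x \<in> M" using phi_diff_M[of \<one> "u \<otimes> x"] u assms i(4) by simp
  moreover have "u \<otimes> x \<oplus> (\<one> \<ominus> u \<otimes> x) = \<one>" using u assms by (simp add: add_minus_cancel)
  ultimately show ?thesis using that u by blast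
qed

text \<open>A nonzero \<open>m\<close> in \<open>M\<close> multiplies \<open>T\<close> into
  \<open>R\<close>, so \<open>m\<close> times a denominator over \<open>T\<close> is a denominator
  over \<open>R\<close>.\<close>

lemma frac_ideal_T_R: "E \<in> frac_ideals K T \<Longrightarrow> E \<in> frac_ideals K R"
proof -
  assume E: "E \<in> frac_ideals K T"
  then obtain d where d: "d \<in> T" "d \<noteq> \<zero>" "\<And>x. x \<in> E \<Longrightarrow> d \<otimes> x \<in> T"
    and sub: "is_submodule K T E" "E \<noteq> {\<zero>}" unfolding T.frac_ideals_iff by auto
  obtain m where m: "m \<in> M" "m \<noteq> \<zero>" by (rule M_elt)
  have "m \<otimes> d \<in> R" "m \<otimes> d \<noteq> \<zero>" using m d integral_iff M_mult by auto
  moreover have "m \<otimes> d \<otimes> x \<in> R" if "x \<in> E" for x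
  proof -
    have "x \<in> carrier K" using that is_submoduleD(1)[OF sub(1)] by auto
    then have "m \<otimes> d \<otimes> x = m \<otimes> (d \<otimes> x)" using m d by (simp add: m_assoc)
    then show ?thesis using m d(3) that M_mult by auto
  qed
  ultimately show ?thesis
    unfolding R.frac_ideals_iff using is_submodule_antimono[OF sub(1)] sub(2) by auto
qed

section \<open>The closure of the common ideal \<open>M\<close>\<close>

lemma M_frac_ideal: "M \<in> frac_ideals K R"
proof -
  obtain m where m: "m \<in> M" "m \<noteq> \<zero>" by (rule M_elt)
  then show ?thesis
    using is_submodule_antimono[OF is_submodule_M] by (intro R.integral_frac_ideal[of M m]) auto
qed

lemma T_frac_ideal: "T \<in> frac_ideals K R"
  by (intro frac_ideal_T_R T.integral_frac_ideal[of T \<one>] is_submodule_subring[OF subring_T]) auto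

text \<open>Every \<open>t\<close> in \<open>T\<close> multiplies \<open>M\<close> into
  \<open>R\<close>. If \<open>\<one>\<close> were in \<open>star M\<close>, scaling by
  \<open>t\<close> would put \<open>t\<close> into \<open>star R = R\<close>, forcing
  \<open>R = T\<close> and so \<open>D = carrier k\<close>.\<close>

lemma one_notin_star_M: "\<one> \<notin> star M"
proof
  assume one: "\<one> \<in> star M"
  have "t \<in> R" if t: "t \<in> T" for t
  proof -
    have "t \<otimes> \<one> \<in> star R"
      using t by (intro R.star_scale[OF M_frac_ideal R.A_frac_ideal _ _ one]) (auto simp: M_mult)
    then show ?thesis using t R.star_A by simp
  qed
  then have "carrier k \<subseteq> D" using phi_surj unfolding R_eq by blast
  then show False using D_proper by blast
qed

text \<open>This supplies the elements outside \<open>M\<close> on which the descent arguments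
  rest.\<close>

lemma star_one_not_subset_M:
  assumes "finite G" "G \<subseteq> carrier K" "\<not> G \<subseteq> {\<zero>}" "\<one> \<in> star (module_span K R G)"
  shows "\<not> G \<subseteq> M"
proof
  assume "G \<subseteq> M"
  then have "module_span K R G \<subseteq> M"
    using is_submodule_antimono[OF is_submodule_M] assms(1) by (intro span_least) auto
  then have "star (module_span K R G) \<subseteq> star M"
    using R.span_frac_ideal[OF assms(1-3)] M_frac_ideal R.star_mono by blast
  then show False using assms(4) one_notin_star_M by blast
qed

section \<open>Transport of submodules and of the star operation between the rings\<close>

lemmas in_T = M_T R_T M_R

lemma is_submodule_phi_image:
  assumes "is_submodule K R E" "E \<subseteq> T"
  shows "is_submodule k D (\<phi> ` E)"
proof (rule is_submoduleI)
  note E = is_submoduleD[OF assms(1)]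
  show "\<phi> ` E \<subseteq> carrier k" using assms(2) by auto
  show "\<zero>\<^bsub>k\<^esub> \<in> \<phi> ` E" using E(2) phi_zero by (metis image_eqI)
  show "x \<oplus>\<^bsub>k\<^esub> y \<in> \<phi> ` E" if "x \<in> \<phi> ` E" "y \<in> \<phi> ` E" for x y
  proof -
    obtain a b where "a \<in> E" "b \<in> E" "x = \<phi> a" "y = \<phi> b" using \<open>x \<in> _\<close> \<open>y \<in> _\<close> by auto
    then show ?thesis
      using E(3) assms(2) by (intro image_eqI[of _ _ "a \<oplus> b"]) (auto simp: subset_iff)
  qed
  show "d \<otimes>\<^bsub>k\<^esub> y \<in> \<phi> ` E" if d: "d \<in> D" and y: "y \<in> \<phi> ` E" for d y
  proof -
    obtain r where r: "r \<in> T" "d = \<phi> r" using phi_surj[OF D_carrier[OF d]] by auto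
    obtain b where "b \<in> E" "y = \<phi> b" using y by auto
    then show ?thesis
      using E(4)[of r b] r d R_iff assms(2) by (intro image_eqI[of _ _ "r \<otimes> b"]) auto
  qed
qed

lemma is_submodule_phi_vimage:
  assumes "is_submodule k D E"
  shows "is_submodule K R {x \<in> T. \<phi> x \<in> E}"
  using is_submoduleD[OF assms] by (intro is_submoduleI) (auto simp: R_iff)

lemma phi_vimage_frac_ideal:
  assumes "is_submodule k D E" "E \<subseteq> D"
  shows "{x \<in> T. \<phi> x \<in> E} \<in> frac_ideals K R"
proof -
  \<comment> \<open>The preimage contains \<open>M\<close>, so it is nonzero even when
    \<open>E\<close> is zero.\<close>
  obtain m where m: "m \<in> M" "m \<noteq> \<zero>" by (rule M_elt)
  then have "m \<in> {x \<in> T. \<phi> x \<in> E}" using is_submoduleD(2)[OF assms(1)] M_iff by (auto simp del: in_T)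
  then show ?thesis
    using R.integral_frac_ideal[OF is_submodule_phi_vimage[OF assms(1)] _ _ m(2)] assms(2) R_iff
    by blast
qed

text \<open>The intersection defining the projection is evaluated just far enough to decide
  membership of the identity. The term for \<open>y = 1\<close> bounds it from above; for the
  reverse direction every \<open>y\<close> is handled by scaling with a lift of its inverse. The
  conclusions supply the hypothesis of \<open>prufer_iff\<close> for \<open>D\<close>, whose
  quotient field may still be smaller than \<open>k\<close> here.\<close>

lemma one_in_star_projection_iff:
  assumes E: "is_submodule k D E" "E \<subseteq> D" "E \<noteq> {\<zero>\<^bsub>k\<^esub>}"
  shows "star_projection T k \<phi> D star E \<subseteq> D"
    "\<one>\<^bsub>k\<^esub> \<in> star_projection T k \<phi> D star E \<longleftrightarrow> \<one> \<in> star {x \<in> T. \<phi> x \<in> E}"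
    "\<one>\<^bsub>k\<^esub> \<in> star_projection T k \<phi> D star E \<Longrightarrow> D \<subseteq> star_projection T k \<phi> D star E"
proof -
  let ?P = "star_projection T k \<phi> D star E" and ?E = "{x \<in> T. \<phi> x \<in> E}"
  note Ek = is_submoduleD[OF E(1)]
  note fE = phi_vimage_frac_ideal[OF E(1,2)]
  have l1: "\<one>\<^bsub>k\<^esub> <#\<^bsub>k\<^esub> X = X" if "X \<subseteq> carrier k" for X
    unfolding l_coset_def using that by (auto simp: subset_iff)
  have star_sub: "star ?E \<subseteq> R" using R.star_subset_A[OF fE] E(2) R_iff by blast
  have inv1: "inv\<^bsub>k\<^esub> \<one>\<^bsub>k\<^esub> = \<one>\<^bsub>k\<^esub>" by simp
  have "\<one>\<^bsub>k\<^esub> \<in> quot_field k D"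
    unfolding quot_field_def using D_simps(2) inv1
    by (intro CollectI exI[of _ "\<one>\<^bsub>k\<^esub>"]) simp
  moreover have "E \<subseteq> \<one>\<^bsub>k\<^esub> <#\<^bsub>k\<^esub> D" using l1[of D] D_proper E(2) by simp
  ultimately have "?P \<subseteq> \<one>\<^bsub>k\<^esub> <#\<^bsub>k\<^esub> (\<phi> ` star {x \<in> T. \<phi> x \<in> inv\<^bsub>k\<^esub> \<one>\<^bsub>k\<^esub> <#\<^bsub>k\<^esub> E})"
    unfolding star_projection_def by blast
  also have "\<dots> = \<phi> ` star ?E"
    using star_sub by (subst inv1, subst l1[OF Ek(1)], subst l1) auto
  finally have P_sub: "?P \<subseteq> \<phi> ` star ?E" .
  also have "\<dots> \<subseteq> D" using star_sub R_iff by blast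
  finally show "?P \<subseteq> D" .
  have 1: "\<one> \<in> star ?E" if one: "\<one>\<^bsub>k\<^esub> \<in> ?P"
  proof -
    obtain x where x: "x \<in> star ?E" "\<one>\<^bsub>k\<^esub> = \<phi> x" using P_sub one by blast
    have xT: "x \<in> T" using x star_sub by auto
    \<comment> \<open>An element \<open>x\<close> of the closure with residue 1 differs from
      \<open>\<one>\<close> by an element of \<open>M\<close>, which the preimage of
      \<open>E\<close> contains.\<close>
    have "\<one> \<ominus> x \<in> M" using phi_diff_M xT x by simp
    then have "\<one> \<ominus> x \<in> ?E" using Ek(2) M_iff by (auto simp del: in_T)
    then have "\<one> \<ominus> x \<in> star ?E" using R.star_extensive[OF fE] by blast
    then have "x \<oplus> (\<one> \<ominus> x) \<in> star ?E" using is_submoduleD(3)[OF R.is_submodule_star[OF fE]] x by blast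
    moreover have "x \<oplus> (\<one> \<ominus> x) = \<one>" using xT by (simp add: add_minus_cancel)
    ultimately show ?thesis by simp
  qed
  have 2: "D \<subseteq> ?P" if one: "\<one> \<in> star ?E"
  proof
    fix d assume d: "d \<in> D"
    have "d \<in> y <#\<^bsub>k\<^esub> (\<phi> ` star {x \<in> T. \<phi> x \<in> inv\<^bsub>k\<^esub> y <#\<^bsub>k\<^esub> E})"
      if y: "y \<in> quot_field k D" "E \<subseteq> y <#\<^bsub>k\<^esub> D" for y
    proof -
      have yc: "y \<in> carrier k" using y(1) k.inv_simps unfolding quot_field_def by auto
      have "y \<noteq> \<zero>\<^bsub>k\<^esub>"
      proof
        assume "y = \<zero>\<^bsub>k\<^esub>"
        moreover have "\<zero>\<^bsub>k\<^esub> <#\<^bsub>k\<^esub> D \<subseteq> {\<zero>\<^bsub>k\<^esub>}" unfolding l_coset_def by auto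
        ultimately have "E \<subseteq> {\<zero>\<^bsub>k\<^esub>}" using y(2) by blast
        then show False using E(3) Ek(2) by auto
      qed
      note i = k.inv_simps[OF yc this]
      let ?yE = "inv\<^bsub>k\<^esub> y <#\<^bsub>k\<^esub> E"
      have mem: "z \<in> ?yE \<longleftrightarrow> z \<in> carrier k \<and> y \<otimes>\<^bsub>k\<^esub> z \<in> E" for z
      proof
        assume "z \<in> ?yE"
        then obtain e where e: "e \<in> E" "z = inv\<^bsub>k\<^esub> y \<otimes>\<^bsub>k\<^esub> e" unfolding l_coset_def by auto
        then show "z \<in> carrier k \<and> y \<otimes>\<^bsub>k\<^esub> z \<in> E"
          using Ek(1) i yc by (auto simp: k.m_assoc[symmetric] subset_iff)
      next
        assume z: "z \<in> carrier k \<and> y \<otimes>\<^bsub>k\<^esub> z \<in> E"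
        then have "z = inv\<^bsub>k\<^esub> y \<otimes>\<^bsub>k\<^esub> (y \<otimes>\<^bsub>k\<^esub> z)" using i yc by (simp add: k.m_assoc[symmetric])
        then show "z \<in> ?yE" unfolding l_coset_def using z by blast
      qed
      have "is_submodule k D {z \<in> carrier k. y \<otimes>\<^bsub>k\<^esub> z \<in> E}"
        using D_proper E(1) yc by (intro k.is_submodule_mult_vimage) auto
      moreover have "?yE = {z \<in> carrier k. y \<otimes>\<^bsub>k\<^esub> z \<in> E}" using mem by blast
      ultimately have sub: "is_submodule k D ?yE" by simp
      have yE: "?yE \<subseteq> D"
      proof
        fix z assume z: "z \<in> ?yE"
        then have "y \<otimes>\<^bsub>k\<^esub> z \<in> y <#\<^bsub>k\<^esub> D" using mem y(2) by blast
        then obtain d' where d': "d' \<in> D" "y \<otimes>\<^bsub>k\<^esub> z = y \<otimes>\<^bsub>k\<^esub> d'" unfolding l_coset_def by auto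
        then have "z = d'" using k.m_lcancel[OF \<open>y \<noteq> _\<close> yc] z mem by auto
        then show "z \<in> D" using d' by simp
      qed
      obtain s where s: "s \<in> T" "\<phi> s = inv\<^bsub>k\<^esub> y" using phi_surj[OF i(1)] by auto
      obtain r where r: "r \<in> T" "\<phi> r = d" using phi_surj[OF D_carrier[OF d]] by auto
      \<comment> \<open>A lift \<open>s\<close> of the inverse of \<open>y\<close> carries the
        preimage of \<open>E\<close> into that of the scaled module, so \<open>s\<close> lies in the
        closure of the latter. Multiplying by a lift \<open>r\<close> of \<open>d\<close> gives an
        element whose residue times \<open>y\<close> is \<open>d\<close>.\<close>
      have "s \<otimes> e \<in> {x \<in> T. \<phi> x \<in> ?yE}" if "e \<in> ?E" for e
        using that s by (auto simp: l_coset_def)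
      then have "s \<otimes> \<one> \<in> star {x \<in> T. \<phi> x \<in> ?yE}"
        by (intro R.star_scale[OF fE phi_vimage_frac_ideal[OF sub yE] _ _ one]) (use s in auto)
      then have "r \<otimes> s \<in> star {x \<in> T. \<phi> x \<in> ?yE}"
        using is_submoduleD(4)[OF R.is_submodule_star[OF phi_vimage_frac_ideal[OF sub yE]], of r s]
          r s d R_iff by simp
      moreover have "d = y \<otimes>\<^bsub>k\<^esub> \<phi> (r \<otimes> s)"
        using r s d yc i by (simp add: k.m_lcomm)
      ultimately show ?thesis unfolding l_coset_def by blast
    qed
    then show "d \<in> ?P" unfolding star_projection_def by blast
  qed
  show "\<one>\<^bsub>k\<^esub> \<in> ?P \<longleftrightarrow> \<one> \<in> star ?E" using 1 2 D_simps(2) by blast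
  show "\<one>\<^bsub>k\<^esub> \<in> ?P \<Longrightarrow> D \<subseteq> ?P" using 1 2 by blast
qed

text \<open>This moves the condition on \<open>D\<close> into \<open>K\<close>: it is expressed by
  \<open>star\<close> on preimages. The product is written \<open>quot_subring.inv_prod k D\<close>
  because \<open>D\<close> is an instance of that locale only under the assumption.\<close>

lemma prufer_projection_iff:
  assumes "quot_field k D = carrier k"
  shows "prufer_star_mult_domain k D (star_projection T k \<phi> D star) \<longleftrightarrow>
    (\<forall>S. finite S \<longrightarrow> S \<subseteq> carrier k \<longrightarrow> \<not> S \<subseteq> {\<zero>\<^bsub>k\<^esub>} \<longrightarrow>
      (\<exists>G. finite G \<and> G \<subseteq> quot_subring.inv_prod k D S \<and> \<not> G \<subseteq> {\<zero>\<^bsub>k\<^esub>} \<and>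
        \<one> \<in> star {x \<in> T. \<phi> x \<in> module_span k D G}))"
proof -
  interpret D: quot_subring k D
    using subring_D assms by (intro quot_subring.intro quot_subring_axioms.intro k.field_axioms)
  have "\<one>\<^bsub>k\<^esub> \<in> star_projection T k \<phi> D star (module_span k D G) \<longleftrightarrow>
      \<one> \<in> star {x \<in> T. \<phi> x \<in> module_span k D G}"
    if "finite S" "S \<subseteq> carrier k" "finite G" "G \<subseteq> D.inv_prod S" "\<not> G \<subseteq> {\<zero>\<^bsub>k\<^esub>}" for S G
  proof (rule one_in_star_projection_iff(2))
    have G: "G \<subseteq> D" using that D.inv_prod_subset by blast
    then show "is_submodule k D (module_span k D G)"
      using k.is_submodule_span[OF subring_D] that(3) by blast
    show "module_span k D G \<subseteq> D"
      using k.span_least[OF k.is_submodule_subring[OF subring_D]] that G by blast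
    show "module_span k D G \<noteq> {\<zero>\<^bsub>k\<^esub>}"
      using that(3,5) G k.span_superset[OF subring_D, of G] by blast
  qed
  moreover have "prufer_star_mult_domain k D (star_projection T k \<phi> D star) \<longleftrightarrow>
    (\<forall>S. finite S \<longrightarrow> S \<subseteq> carrier k \<longrightarrow> \<not> S \<subseteq> {\<zero>\<^bsub>k\<^esub>} \<longrightarrow>
      (\<exists>G. finite G \<and> G \<subseteq> D.inv_prod S \<and> \<not> G \<subseteq> {\<zero>\<^bsub>k\<^esub>} \<and>
        \<one>\<^bsub>k\<^esub> \<in> star_projection T k \<phi> D star (module_span k D G)))"
  proof (rule D.prufer_iff)
    fix J assume J: "J \<in> fg_frac_ideals k D" "J \<subseteq> D"
    then have "is_submodule k D J" "J \<noteq> {\<zero>\<^bsub>k\<^esub>}"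
      unfolding fg_frac_ideals_def D.frac_ideals_iff by auto
    then show "star_projection T k \<phi> D star J \<subseteq> D \<and>
      (\<one>\<^bsub>k\<^esub> \<in> star_projection T k \<phi> D star J \<longrightarrow> D \<subseteq> star_projection T k \<phi> D star J)"
      using one_in_star_projection_iff J(2) by blast
  qed
  ultimately show ?thesis by (smt (verit))
qed

lemma prufer_extension_iff:
  "prufer_star_mult_domain K T (star_extension K T star) \<longleftrightarrow>
    (\<forall>S. finite S \<longrightarrow> S \<subseteq> carrier K \<longrightarrow> \<not> S \<subseteq> {\<zero>} \<longrightarrow>
      (\<exists>G. finite G \<and> G \<subseteq> T.inv_prod S \<and> \<not> G \<subseteq> {\<zero>} \<and>
        \<one> \<in> star_extension K T star (module_span K T G)))"
proof (rule T.prufer_iff)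
  fix J assume "J \<in> fg_frac_ideals K T" and JT: "J \<subseteq> T"
  then have J: "J \<in> frac_ideals K T" unfolding fg_frac_ideals_def by auto
  note fJ = frac_ideal_T_R[OF J]
  have Js: "is_submodule K T J" using J T.frac_ideals_iff by blast
  \<comment> \<open>As \<open>J\<close> lies in \<open>T\<close>, its inverse contains
    \<open>\<one>\<close>, so the double inverse lies in \<open>T\<close>.\<close>
  have "\<one> \<in> frac_inverse K T J" unfolding frac_inverse_def T.quot_field using JT by auto
  then have "v_operation K T J \<subseteq> T"
    unfolding v_operation_def frac_inverse_def[of K T "frac_inverse K T J"] T.quot_field by force
  moreover have "t \<in> star_extension K T star J"
    if one: "\<one> \<in> star_extension K T star J" and t: "t \<in> T" for t
  proof -
    have "t \<otimes> \<one> \<in> star J"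
      using one t is_submoduleD(4)[OF Js t] unfolding star_extension_def
      by (intro R.star_scale[OF fJ fJ]) auto
    moreover have "t \<in> v_operation K T J"
    proof -
      \<comment> \<open>Membership of \<open>\<one>\<close> in the double inverse says that the
        inverse of \<open>J\<close> lies in \<open>T\<close>; then every element of \<open>T\<close>
        belongs to the double inverse.\<close>
      have "\<one> \<otimes> y \<in> T" if "y \<in> frac_inverse K T J" for y
        using one that unfolding star_extension_def v_operation_def
          frac_inverse_def[of K T "frac_inverse K T J"] by auto
      moreover have "y \<in> carrier K" if "y \<in> frac_inverse K T J" for y
        using that T.quot_field unfolding frac_inverse_def by simp
      ultimately have "y \<in> T" if "y \<in> frac_inverse K T J" for y
        using that l_one by metis
      then show ?thesis
        unfolding v_operation_def frac_inverse_def[of K T "frac_inverse K T J"] T.quot_field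
        using t by auto
    qed
    ultimately show ?thesis unfolding star_extension_def using t by simp
  qed
  ultimately show "star_extension K T star J \<subseteq> T \<and>
      (\<one> \<in> star_extension K T star J \<longrightarrow> T \<subseteq> star_extension K T star J)"
    unfolding star_extension_def by blast
qed

text \<open>The preimage of a nonzero finitely generated \<open>D\<close>-module is finitely
  generated over \<open>R\<close>. A nonzero element of \<open>B\<close> provides a lift outside
  \<open>M\<close>, hence a relation making the generators comaximal in \<open>T\<close>.
  Comaximality also gives the last conclusion, which ensures that elements of the inverse of
  \<open>S\<close> have residues in \<open>k\<close>.\<close>

lemma lift_generators:
  assumes B: "finite B" "B \<subseteq> carrier k" "\<not> B \<subseteq> {\<zero>\<^bsub>k\<^esub>}"
  obtains S where "finite S" "S \<subseteq> T" "\<not> S \<subseteq> {\<zero>}" "\<phi> ` S \<subseteq> module_span k D B" "B \<subseteq> \<phi> ` S"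
    "{x \<in> T. \<phi> x \<in> module_span k D B} \<subseteq> module_span K R S"
    "\<forall>x\<in>carrier K. (\<forall>s\<in>S. x \<otimes> s \<in> T) \<longrightarrow> x \<in> T"
proof -
  obtain f where f: "f b \<in> T" "\<phi> (f b) = b" if "b \<in> B" for b
    using phi_surj B(2) by (metis subsetD)
  obtain b where b: "b \<in> B" "b \<noteq> \<zero>\<^bsub>k\<^esub>" using B(3) by auto
  then have "f b \<notin> M" using f M_iff by (auto simp del: in_T)
  then obtain u m where um: "u \<in> T" "m \<in> M" "u \<otimes> f b \<oplus> m = \<one>"
    using inverse_mod_M f(1)[OF b(1)] by metis
  \<comment> \<open>Adjoining \<open>m\<close> makes \<open>S\<close> generate the unit ideal of \<open>T\<close>, so the span over \<open>R\<close> contains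
    \<open>M = MT\<close>.\<close>
  define S where "S = insert m (f ` B)"
  have S: "finite S" "S \<subseteq> T" using B(1) f um unfolding S_def by auto
  have Sc: "S \<subseteq> carrier K" using S by auto
  have fbm: "f b \<in> S" "m \<in> S" unfolding S_def using b by auto
  have fbT: "f b \<in> T" using f b by auto
  have decomp: "x = (x \<otimes> u) \<otimes> f b \<oplus> x \<otimes> m" if "x \<in> carrier K" for x
  proof -
    have "x \<otimes> (u \<otimes> f b \<oplus> m) = (x \<otimes> u) \<otimes> f b \<oplus> x \<otimes> m"
      using um(1,2) fbT that by (simp add: r_distr m_assoc)
    then show ?thesis using um(3) that by simp
  qed
  note sp = is_submodule_span[OF subring_R S(1) Sc] and ss = span_superset[OF subring_R S(1) Sc]
  note spB = k.is_submodule_span[OF subring_D B(1,2)]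
    and ssB = k.span_superset[OF subring_D B(1,2)]
  \<comment> \<open>In \<open>decomp\<close> the coefficients \<open>x \<otimes> u\<close> and
    \<open>x\<close> both lie in \<open>M\<close> when \<open>x\<close> does, so they are scalars
    from \<open>R\<close>.\<close>
  have "M \<subseteq> module_span K R S"
  proof
    fix x assume x: "x \<in> M"
    then have "(x \<otimes> u) \<otimes> f b \<in> module_span K R S" "x \<otimes> m \<in> module_span K R S"
      using is_submoduleD(4)[OF sp] ss fbm M_mult um by blast+
    then show "x \<in> module_span K R S"
      using decomp[of x] x is_submoduleD(3)[OF sp] by fastforce
  qed
  moreover have spT: "module_span K R S \<subseteq> T"
    using S is_submodule_antimono[OF is_submodule_subring[OF subring_T], of R]
    by (intro span_least) auto
  moreover have B\<phi>: "B \<subseteq> \<phi> ` S"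
  proof
    fix c assume "c \<in> B"
    then show "c \<in> \<phi> ` S" using f[of c] unfolding S_def by (intro image_eqI[of _ _ "f c"]) auto
  qed
  moreover have "module_span k D B \<subseteq> \<phi> ` module_span K R S"
    using B\<phi> ss B(1) by (intro k.span_least is_submodule_phi_image sp spT) auto
  ultimately have "{x \<in> T. \<phi> x \<in> module_span k D B} \<subseteq> module_span K R S"
  proof (intro subsetI)
    fix x assume "x \<in> {x \<in> T. \<phi> x \<in> module_span k D B}"
    then obtain y where y: "x \<in> T" "y \<in> module_span K R S" "\<phi> x = \<phi> y"
      using \<open>module_span k D B \<subseteq> _\<close> by auto
    then have yT: "y \<in> T" using spT by auto
    then have "x \<ominus> y \<in> module_span K R S" using \<open>M \<subseteq> _\<close> phi_diff_M y by blast
    then have "y \<oplus> (x \<ominus> y) \<in> module_span K R S" using is_submoduleD(3)[OF sp] y by blast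
    moreover have "y \<oplus> (x \<ominus> y) = x" using y(1) yT by (simp add: add_minus_cancel)
    ultimately show "x \<in> module_span K R S" by simp
  qed
  moreover have "x \<in> T" if x: "x \<in> carrier K" "\<forall>s\<in>S. x \<otimes> s \<in> T" for x
  proof -
    have "(x \<otimes> u) \<otimes> f b = u \<otimes> (x \<otimes> f b)" using x(1) um fbT by (simp add: m_ac)
    then have "(x \<otimes> u) \<otimes> f b \<oplus> x \<otimes> m \<in> T" using x(2) fbm um by simp
    then show ?thesis using decomp[OF x(1)] by simp
  qed
  moreover have "\<phi> ` S \<subseteq> module_span k D B"
    using f ssB um(2) M_iff is_submoduleD(2)[OF spB] unfolding S_def by (auto simp del: in_T)
  moreover have "\<not> S \<subseteq> {\<zero>}"
  proof
    assume "S \<subseteq> {\<zero>}"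
    then have "f b = \<zero>" using fbm by auto
    then show False using f[OF b(1)] b(2) by simp
  qed
  ultimately show ?thesis using S B\<phi> by (intro that[of S]) blast+
qed

section \<open>Descent from the pullback\<close>

text \<open>If each element of the inverse sent all generators into \<open>M\<close>, it would send
  their whole span there, and sums of such products would stay in \<open>M\<close>.\<close>

lemma inv_prod_not_subset_M:
  assumes S: "finite S" "S \<subseteq> carrier K" and "\<not> R.inv_prod S \<subseteq> M"
  obtains y s where "y \<in> carrier K" "s \<in> S" "\<forall>t\<in>S. y \<otimes> t \<in> R" "y \<otimes> s \<notin> M"
proof -
  have "\<exists>y\<in>carrier K. (\<forall>t\<in>S. y \<otimes> t \<in> R) \<and> \<not> (\<forall>t\<in>S. y \<otimes> t \<in> M)"
  proof (rule ccontr)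
    assume *: "\<not> ?thesis"
    have MR: "is_submodule K R M" using is_submodule_antimono[OF is_submodule_M] by auto
    have "R.inv_prod S \<subseteq> M"
      unfolding R.inv_prod_def
    proof (rule ideal_prod_least[OF MR])
      fix i j assume i: "i \<in> module_span K R S" and j: "j \<in> {x \<in> carrier K. \<forall>s\<in>S. x \<otimes> s \<in> R}"
      have "is_submodule K R {x \<in> carrier K. j \<otimes> x \<in> M}"
        using j R.A_sub by (intro is_submodule_mult_vimage MR) auto
      then have "module_span K R S \<subseteq> {x \<in> carrier K. j \<otimes> x \<in> M}"
        using * j S by (intro span_least) auto
      then show "i \<otimes> j \<in> M" using i j m_comm by auto
    qed
    then show False using assms(3) by simp
  qed
  then show ?thesis using that by blast
qed

text \<open>Both the quotient field of \<open>D\<close> and the valuation property follow from this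
  for two generators, one of them \<open>\<one>\<close>.\<close>

lemma prufer_inverse_not_subset_M:
  assumes "prufer_star_mult_domain K R star" and S: "finite S" "S \<subseteq> carrier K" "\<not> S \<subseteq> {\<zero>}"
  obtains y s where "y \<in> carrier K" "s \<in> S" "\<forall>t\<in>S. y \<otimes> t \<in> R" "y \<otimes> s \<notin> M"
proof -
  obtain G where G: "finite G" "G \<subseteq> R.inv_prod S" "\<not> G \<subseteq> {\<zero>}" "\<one> \<in> star (module_span K R G)"
    using assms unfolding R.prufer_star_iff by metis
  have "G \<subseteq> carrier K" using G(2) R.inv_prod_subset[OF S(1,2)] by auto
  then have "\<not> R.inv_prod S \<subseteq> M" using star_one_not_subset_M G by blast
  then show ?thesis using inv_prod_not_subset_M[OF S(1,2)] that by blast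
qed

text \<open>With \<open>S = {\<one>, t}\<close> both \<open>y\<close> and
  \<open>y \<otimes> t\<close> lie in \<open>R\<close>. If \<open>y\<close> were in
  \<open>M\<close>, both would be, against the choice of \<open>y\<close>. Hence
  \<open>\<phi> y\<close> is nonzero and the residue of \<open>t\<close> is a quotient of two
  elements of \<open>D\<close>.\<close>

lemma prufer_quot_field_D:
  assumes "prufer_star_mult_domain K R star"
  shows "quot_field k D = carrier k"
proof
  show "quot_field k D \<subseteq> carrier k" using k.inv_simps unfolding quot_field_def by auto
  show "carrier k \<subseteq> quot_field k D"
  proof
    fix z assume z: "z \<in> carrier k"
    obtain t where t: "t \<in> T" "\<phi> t = z" using phi_surj[OF z] by auto
    have S: "finite {\<one>, t}" "{\<one>, t} \<subseteq> carrier K" "\<not> {\<one>, t} \<subseteq> {\<zero>}" using t(1) by auto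
    obtain y s where y: "y \<in> carrier K" "s \<in> {\<one>, t}" "\<forall>t\<in>{\<one>, t}. y \<otimes> t \<in> R" "y \<otimes> s \<notin> M"
      by (rule prufer_inverse_not_subset_M[OF assms S])
    have yR: "y \<in> R" "y \<otimes> t \<in> R" using y(1,3) by auto
    have "y \<notin> M" using y M_mult t(1) by auto
    then have d: "\<phi> y \<noteq> \<zero>\<^bsub>k\<^esub>" using yR M_iff by (auto simp del: in_T)
    note i = k.inv_simps[OF phi_carrier[OF R_T[OF yR(1)]] d]
    have "z = \<phi> (y \<otimes> t) \<otimes>\<^bsub>k\<^esub> inv\<^bsub>k\<^esub> \<phi> y"
    proof -
      have "\<phi> (y \<otimes> t) \<otimes>\<^bsub>k\<^esub> inv\<^bsub>k\<^esub> \<phi> y = z \<otimes>\<^bsub>k\<^esub> (\<phi> y \<otimes>\<^bsub>k\<^esub> inv\<^bsub>k\<^esub> \<phi> y)"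
        using t yR(1) z i(1) by (simp add: k.m_ac)
      then show ?thesis using i z by simp
    qed
    moreover have "\<phi> (y \<otimes> t) \<in> D" "\<phi> y \<in> D" using yR R_iff by (auto simp del: in_T)
    ultimately show "z \<in> quot_field k D" unfolding quot_field_def using d by blast
  qed
qed

section \<open>The localization of \<open>T\<close> at \<open>M\<close>\<close>

lemma M_prime:
  assumes "x \<in> T" "y \<in> T" "x \<notin> M" "y \<notin> M"
  shows "x \<otimes> y \<notin> M"
  using assms k.integral_iff[of "\<phi> x" "\<phi> y"] M_iff by (auto simp del: in_T)

lemma zero_M [simp]: "\<zero> \<in> M"
  using is_submoduleD(2)[OF is_submodule_M] .

lemma one_notin_M [simp]: "\<one> \<notin> M"
  using M_iff by simp

lemma localization_iff:
  "x \<in> localization_at K T M \<longleftrightarrow> x \<in> carrier K \<and> (\<exists>s\<in>T - M. s \<otimes> x \<in> T)"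
proof
  assume "x \<in> localization_at K T M"
  then obtain a s where as: "x = a \<otimes> inv s" "a \<in> T" "s \<in> T - M" unfolding localization_at_def by auto
  then have "s \<noteq> \<zero>" by auto
  note i = inv_simps[OF _ this]
  have "s \<otimes> x = a \<otimes> (s \<otimes> inv s)" using as i(1) by (simp add: m_ac)
  then have "s \<otimes> x = a" using as i(3) by simp
  moreover have "x \<in> carrier K" using as i(1) by auto
  ultimately show "x \<in> carrier K \<and> (\<exists>s\<in>T - M. s \<otimes> x \<in> T)"
    using as(2,3) by (intro conjI bexI[of _ s]) simp_all
next
  assume "x \<in> carrier K \<and> (\<exists>s\<in>T - M. s \<otimes> x \<in> T)"
  then obtain s where s: "x \<in> carrier K" "s \<in> T" "s \<notin> M" "s \<otimes> x \<in> T" by auto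
  then have "s \<noteq> \<zero>" by auto
  note i = inv_simps[OF _ this]
  have "s \<otimes> x \<otimes> inv s = x \<otimes> (s \<otimes> inv s)" using s(1,2) i(1) by (simp add: m_ac)
  then have "x = s \<otimes> x \<otimes> inv s" using s i by simp
  then show "x \<in> localization_at K T M" unfolding localization_at_def using s by blast
qed

lemma subring_localization: "subring (localization_at K T M) K"
proof (rule subringI)
  show "localization_at K T M \<subseteq> carrier K" using localization_iff by auto
  show "\<one> \<in> localization_at K T M" unfolding localization_iff by (intro conjI bexI[of _ \<one>]) auto
  show "\<ominus> x \<in> localization_at K T M" if x: "x \<in> localization_at K T M" for x
  proof -
    obtain s where s: "x \<in> carrier K" "s \<in> T - M" "s \<otimes> x \<in> T"
      using x[unfolded localization_iff] by metis
    have "s \<in> carrier K" using s(2) T.A_sub by blast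
    then have "s \<otimes> \<ominus> x = \<ominus> (s \<otimes> x)" using s(1) by (rule r_minus)
    then have "s \<otimes> \<ominus> x \<in> T" using T_simps(3)[OF s(3)] by metis
    then show ?thesis using s(1,2) by (subst localization_iff) (intro conjI bexI[of _ s] a_inv_closed)
  qed
next
  fix x y assume "x \<in> localization_at K T M" "y \<in> localization_at K T M"
  then obtain s t where st: "x \<in> carrier K" "y \<in> carrier K" "s \<in> T" "s \<notin> M" "t \<in> T" "t \<notin> M"
    "s \<otimes> x \<in> T" "t \<otimes> y \<in> T"
    unfolding localization_iff by auto
  have "s \<otimes> t \<in> T - M" using st M_prime by auto
  moreover have "(s \<otimes> t) \<otimes> (x \<otimes> y) = (s \<otimes> x) \<otimes> (t \<otimes> y)"
    "(s \<otimes> t) \<otimes> (x \<oplus> y) = t \<otimes> (s \<otimes> x) \<oplus> s \<otimes> (t \<otimes> y)"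
    using st(1-3,5) by (simp_all add: m_ac r_distr)
  then have "(s \<otimes> t) \<otimes> (x \<otimes> y) \<in> T" "(s \<otimes> t) \<otimes> (x \<oplus> y) \<in> T" using st by simp_all
  ultimately show "x \<otimes> y \<in> localization_at K T M" "x \<oplus> y \<in> localization_at K T M"
    unfolding localization_iff using st(1,2) by auto
qed

text \<open>With \<open>S = {\<one>, x}\<close> one of \<open>y\<close> and
  \<open>y \<otimes> x\<close> lies outside \<open>M\<close>, and both lie in \<open>R\<close>. In
  the first case \<open>y\<close> is a denominator for \<open>x\<close>, in the second
  \<open>y \<otimes> x\<close> is one for \<open>inv x\<close>.\<close>

lemma prufer_valuation_domain:
  assumes "prufer_star_mult_domain K R star"
  shows "valuation_domain K (localization_at K T M)"
  unfolding valuation_domain_def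
proof (intro conjI ballI subdomainI' subring_localization)
  fix x assume "x \<in> quot_field K (localization_at K T M) - {\<zero>}"
  then have x: "x \<in> carrier K" "x \<noteq> \<zero>"
    using localization_iff inv_simps unfolding quot_field_def by auto
  note i = inv_simps[OF x]
  have S: "finite {\<one>, x}" "{\<one>, x} \<subseteq> carrier K" "\<not> {\<one>, x} \<subseteq> {\<zero>}" using x(1) by auto
  obtain y s where y: "y \<in> carrier K" "s \<in> {\<one>, x}" "\<forall>t\<in>{\<one>, x}. y \<otimes> t \<in> R" "y \<otimes> s \<notin> M"
    by (rule prufer_inverse_not_subset_M[OF assms S])
  have yR: "y \<in> R" "y \<otimes> x \<in> R" using y(1,3) by auto
  have "y \<otimes> x \<otimes> inv x = y" using x(1) y(1) i by (simp add: m_assoc)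
  then show "x \<in> localization_at K T M \<or> inv x \<in> localization_at K T M"
    unfolding localization_iff using y(1,2,4) yR x(1) i(1) by (metis DiffI R_T insertE r_one singletonD)
qed

text \<open>The set \<open>G\<close> for \<open>R\<close> is kept. Enlarging scalars preserves
  \<open>\<one>\<close> in the closure; the v-part amounts to showing that the inverse of the
  \<open>T\<close>-span of \<open>G\<close> lies in \<open>T\<close>.\<close>

lemma prufer_extension:
  assumes "prufer_star_mult_domain K R star"
  shows "prufer_star_mult_domain K T (star_extension K T star)"
  unfolding prufer_extension_iff
proof (intro allI impI)
  fix S assume S: "finite S" "S \<subseteq> carrier K" "\<not> S \<subseteq> {\<zero>}"
  obtain G where G: "finite G" "G \<subseteq> R.inv_prod S" "\<not> G \<subseteq> {\<zero>}" "\<one> \<in> star (module_span K R G)"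
    using assms S unfolding R.prufer_star_iff by metis
  have GR: "G \<subseteq> R" using G(2) R.inv_prod_subset[OF S(1,2)] by auto
  then have Gc: "G \<subseteq> carrier K" by auto
  have RT: "R \<subseteq> T" by auto
  have "R.inv_prod S \<subseteq> T.inv_prod S"
    unfolding R.inv_prod_def T.inv_prod_def using S RT
    by (intro ideal_prod_mono span_mono subring_R subring_T) auto
  moreover have "\<one> \<in> star (module_span K T G)"
  proof -
    have "module_span K R G \<subseteq> module_span K T G"
      using G(1) Gc by (intro span_mono subring_R subring_T RT) auto
    then show ?thesis
      using R.star_mono[OF R.span_frac_ideal frac_ideal_T_R[OF T.span_frac_ideal]] G Gc by blast
  qed
  moreover have "\<one> \<in> v_operation K T (module_span K T G)"
  proof -
    have inT: "y \<in> T" if y: "y \<in> carrier K" "\<And>g. g \<in> G \<Longrightarrow> y \<otimes> g \<in> T" for y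
    proof -
      have "is_submodule K R {x \<in> carrier K. y \<otimes> x \<in> T}"
        using R.A_sub y(1) is_submodule_antimono[OF is_submodule_subring[OF subring_T] RT]
        by (intro is_submodule_mult_vimage) auto
      then have "module_span K R G \<subseteq> {x \<in> carrier K. y \<otimes> x \<in> T}"
        using y(2) G(1) Gc by (intro span_least) auto
      \<comment> \<open>Scaling by \<open>y\<close> only gives \<open>y \<in> star T\<close>, which
        may exceed \<open>T\<close>. The relation \<open>u \<otimes> g \<oplus> m = \<one>\<close>
        with \<open>g\<close> in \<open>G\<close> repairs this: \<open>y \<otimes> g\<close> is in
        \<open>T\<close> by assumption, and \<open>m \<otimes> y\<close> is in
        \<open>star R = R\<close> because \<open>m\<close> multiplies \<open>T\<close> into
        \<open>R\<close>.\<close>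
      then have "y \<otimes> \<one> \<in> star T"
        using G Gc y(1)
        by (intro R.star_scale[OF R.span_frac_ideal T_frac_ideal]) auto
      then have ys: "y \<in> star T" using y(1) by simp
      obtain g where g: "g \<in> G" "g \<notin> M" using star_one_not_subset_M[OF G(1) Gc G(3,4)] by auto
      have gT: "g \<in> T" using g GR by auto
      obtain u m where um: "u \<in> T" "m \<in> M" "u \<otimes> g \<oplus> m = \<one>"
        using inverse_mod_M[OF gT g(2)] .
      have "m \<otimes> y \<in> star R"
        using um M_mult by (intro R.star_scale[OF T_frac_ideal R.A_frac_ideal _ _ ys]) auto
      then have "m \<otimes> y \<in> T" using R.star_A by auto
      moreover have "u \<otimes> (y \<otimes> g) \<in> T" using y(2) g um by auto
      moreover have "y = u \<otimes> (y \<otimes> g) \<oplus> m \<otimes> y"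
      proof -
        have "y = y \<otimes> (u \<otimes> g \<oplus> m)" using um y by simp
        also have "\<dots> = u \<otimes> (y \<otimes> g) \<oplus> m \<otimes> y" using um(1,2) y(1) gT by (simp add: r_distr m_ac)
        finally show ?thesis .
      qed
      ultimately show ?thesis using T_simps(5) by metis
    qed
    have "\<one> \<otimes> y \<in> T" if "y \<in> {x \<in> carrier K. \<forall>s\<in>G. x \<otimes> s \<in> T}" for y
    proof -
      have "y \<in> carrier K" "\<And>g. g \<in> G \<Longrightarrow> y \<otimes> g \<in> T" using that by auto
      then show ?thesis using inT[of y] by simp
    qed
    then have "\<one> \<in> frac_inverse K T {x \<in> carrier K. \<forall>s\<in>G. x \<otimes> s \<in> T}"
      unfolding frac_inverse_def T.quot_field by blast
    then show ?thesis unfolding v_operation_def T.frac_inverse_span[OF G(1) Gc] .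
  qed
  ultimately show "\<exists>G. finite G \<and> G \<subseteq> T.inv_prod S \<and> \<not> G \<subseteq> {\<zero>} \<and>
      \<one> \<in> star_extension K T star (module_span K T G)"
    unfolding star_extension_def using G by blast
qed

text \<open>Lift \<open>B\<close> to \<open>S\<close>, take \<open>G\<close> for \<open>S\<close>,
  and project it. Since \<open>G\<close> is not contained in \<open>M\<close>, its image is nonzero,
  and the preimage of the span of that image contains the \<open>R\<close>-span of
  \<open>G\<close>.\<close>

lemma prufer_projection:
  assumes "prufer_star_mult_domain K R star"
  shows "prufer_star_mult_domain k D (star_projection T k \<phi> D star)"
  unfolding prufer_projection_iff[OF prufer_quot_field_D[OF assms]]
proof (intro allI impI)
  interpret D: quot_subring k D
    using subring_D prufer_quot_field_D[OF assms]
    by (intro quot_subring.intro quot_subring_axioms.intro k.field_axioms)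
  fix B assume B: "finite B" "B \<subseteq> carrier k" "\<not> B \<subseteq> {\<zero>\<^bsub>k\<^esub>}"
  obtain S where S: "finite S" "S \<subseteq> T" "\<not> S \<subseteq> {\<zero>}" "\<phi> ` S \<subseteq> module_span k D B" "B \<subseteq> \<phi> ` S"
    "{x \<in> T. \<phi> x \<in> module_span k D B} \<subseteq> module_span K R S"
    "\<forall>x\<in>carrier K. (\<forall>s\<in>S. x \<otimes> s \<in> T) \<longrightarrow> x \<in> T"
    by (rule lift_generators[OF B])
  have Sc: "S \<subseteq> carrier K" using S(2) by auto
  obtain G where G: "finite G" "G \<subseteq> R.inv_prod S" "\<not> G \<subseteq> {\<zero>}" "\<one> \<in> star (module_span K R G)"
    using assms S(1,3) Sc unfolding R.prufer_star_iff by metis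
  have GR: "G \<subseteq> R" using G(2) R.inv_prod_subset[OF S(1) Sc] by auto
  then have Gc: "G \<subseteq> carrier K" by auto
  have "R.inv_prod S \<subseteq> {x \<in> T. \<phi> x \<in> D.inv_prod B}"
    unfolding R.inv_prod_def
  proof (rule ideal_prod_least)
    show "is_submodule K R {x \<in> T. \<phi> x \<in> D.inv_prod B}"
      by (intro is_submodule_phi_vimage D.is_submodule_inv_prod B)
    fix i j assume i: "i \<in> module_span K R S" and j: "j \<in> {x \<in> carrier K. \<forall>s\<in>S. x \<otimes> s \<in> R}"
    have "module_span K R S \<subseteq> {x \<in> T. \<phi> x \<in> module_span k D B}"
      using S(1,2,4)
      by (intro span_least is_submodule_phi_vimage k.is_submodule_span subring_D B) auto
    then have iT: "i \<in> T" "\<phi> i \<in> module_span k D B" using i by auto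
    \<comment> \<open>The comaximality built into \<open>S\<close> makes \<open>j\<close> integral
      over the generators' ring \<open>T\<close>, in the sense of membership, so
      \<open>\<phi> j\<close> can be used as an element of the inverse of the span of
      \<open>B\<close>.\<close>
    have jT: "j \<in> T" using j S(7) by blast
    have "\<phi> j \<otimes>\<^bsub>k\<^esub> b \<in> D" if b: "b \<in> B" for b
    proof -
      obtain s where s: "s \<in> S" "b = \<phi> s" using S(5) b by auto
      then have "\<phi> (j \<otimes> s) \<in> D" using j R_iff by (auto simp del: in_T)
      then show ?thesis using s S(2) jT by auto
    qed
    then have "\<phi> i \<otimes>\<^bsub>k\<^esub> \<phi> j \<in> D.inv_prod B"
      unfolding D.inv_prod_def using iT jT by (intro ideal_prod.prod) auto
    then show "i \<otimes> j \<in> {x \<in> T. \<phi> x \<in> D.inv_prod B}" using iT jT by simp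
  qed
  then have G\<phi>: "\<phi> ` G \<subseteq> D.inv_prod B" using G(2) by auto
  then have G\<phi>D: "\<phi> ` G \<subseteq> D" using D.inv_prod_subset[OF B(1,2)] by auto
  then have G\<phi>c: "\<phi> ` G \<subseteq> carrier k" by auto
  have "\<not> G \<subseteq> M" using star_one_not_subset_M[OF G(1) Gc G(3,4)] .
  then obtain g where "g \<in> G" "g \<notin> M" by blast
  then have "g \<in> G" "\<phi> g \<noteq> \<zero>\<^bsub>k\<^esub>" using GR R_T M_iff by blast+
  then have "\<not> \<phi> ` G \<subseteq> {\<zero>\<^bsub>k\<^esub>}" by auto
  moreover have "\<one> \<in> star {x \<in> T. \<phi> x \<in> module_span k D (\<phi> ` G)}"
  proof -
    note sp = k.is_submodule_span[OF subring_D finite_imageI[OF G(1)] G\<phi>c]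
    have "module_span K R G \<subseteq> {x \<in> T. \<phi> x \<in> module_span k D (\<phi> ` G)}"
      using k.span_superset[OF subring_D finite_imageI[OF G(1)] G\<phi>c] GR
      by (intro span_least is_submodule_phi_vimage sp G(1)) auto
    moreover have "module_span k D (\<phi> ` G) \<subseteq> D"
      using G\<phi>D G(1) by (intro k.span_least k.is_submodule_subring subring_D) auto
    ultimately show ?thesis
      using R.star_mono[OF R.span_frac_ideal[OF G(1) Gc G(3)] phi_vimage_frac_ideal[OF sp]] G(4)
      by blast
  qed
  ultimately show "\<exists>G. finite G \<and> G \<subseteq> D.inv_prod B \<and> \<not> G \<subseteq> {\<zero>\<^bsub>k\<^esub>} \<and>
      \<one> \<in> star {x \<in> T. \<phi> x \<in> module_span k D G}"
    using G\<phi> G(1) by blast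
qed

section \<open>Ascent to the pullback\<close>

text \<open>Over a valuation domain a finitely generated module is generated by one of its
  generators; the induction compares the current divisor \<open>a\<close> with the new element
  \<open>x\<close>.\<close>

lemma valuation_divides_all:
  assumes V: "valuation_domain K (localization_at K T M)"
    and S: "finite S" "S \<subseteq> carrier K" "\<not> S \<subseteq> {\<zero>}"
  shows "\<exists>a\<in>S. a \<noteq> \<zero> \<and> (\<forall>x\<in>S. inv a \<otimes> x \<in> localization_at K T M)"
  using S
proof (induction S rule: finite_induct)
  case empty
  then show ?case by simp
next
  case (insert x S)
  let ?V = "localization_at K T M"
  note V_simps = subringE[OF subring_localization]
  have x: "x \<in> carrier K" and Sc: "S \<subseteq> carrier K" using insert.prems by auto
  consider "x = \<zero>" | "x \<noteq> \<zero>" "S \<subseteq> {\<zero>}" | "x \<noteq> \<zero>" "\<not> S \<subseteq> {\<zero>}" by blast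
  then show ?case
  proof cases
    case 1
    then obtain a where "a \<in> S" "a \<noteq> \<zero>" "\<forall>x\<in>S. inv a \<otimes> x \<in> ?V" using insert by auto
    then show ?thesis using 1 V_simps(2) inv_simps Sc by (intro bexI[of _ a]) auto
  next
    case 2
    then show ?thesis using inv_simps[OF x] V_simps(2,3) by (intro bexI[of _ x]) auto
  next
    case 3
    then obtain a where a: "a \<in> S" "a \<noteq> \<zero>" "\<And>y. y \<in> S \<Longrightarrow> inv a \<otimes> y \<in> ?V" using insert by auto
    have ac: "a \<in> carrier K" using a Sc by auto
    note i = inv_simps[OF ac a(2)] and ix = inv_simps[OF x 3(1)]
    let ?z = "inv a \<otimes> x"
    have z: "?z \<in> carrier K" "?z \<noteq> \<zero>" using i ix x 3 integral_iff by auto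
    note iz = inv_simps[OF z]
    have "?z \<in> quot_field K ?V"
    proof -
      have "T \<subseteq> ?V" 
        by (intro subsetI, subst localization_iff)
          (intro conjI bexI[of _ \<one>], auto)
      then have "quot_field K T \<subseteq> quot_field K ?V" unfolding quot_field_def by blast
      then show ?thesis using z quot_T by auto
    qed
    then consider "?z \<in> ?V" | "inv ?z \<in> ?V" using V z(2) unfolding valuation_domain_def by auto
    then show ?thesis
    proof cases
      case 1
      then show ?thesis using a by (intro bexI[of _ a]) auto
    next
      case 2
      \<comment> \<open>Here \<open>x\<close> divides \<open>a\<close>, so it takes over as divisor
        of everything \<open>a\<close> divides.\<close>
      have "inv x \<otimes> y \<in> ?V" if y: "y \<in> S" for y
      proof -
        have yc: "y \<in> carrier K" using y Sc by auto
        have "inv x \<otimes> y = inv x \<otimes> (?z \<otimes> inv ?z) \<otimes> y" using iz ix yc by simp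
        also have "\<dots> = (inv x \<otimes> x) \<otimes> (inv ?z \<otimes> (inv a \<otimes> y))"
          using i(1) ix(1) x yc iz(1) by (simp add: m_ac)
        also have "\<dots> = inv ?z \<otimes> (inv a \<otimes> y)" using ix iz(1) i(1) yc by simp
        finally show ?thesis using V_simps(6)[OF 2 a(3)[OF y]] by simp
      qed
      then show ?thesis using V_simps(3) ix 3(1) by (intro bexI[of _ x]) auto
    qed
  qed
qed

text \<open>The localizations of \<open>T\<close> and \<open>R\<close> at \<open>M\<close> agree
  when \<open>k\<close> is the quotient field of \<open>D\<close>: denominators in \<open>T\<close>
  outside \<open>M\<close> can be moved into \<open>R\<close>. Finitely many denominators are then
  multiplied, which stays outside \<open>M\<close> by primeness.\<close>

lemma common_denominator_outside_M:
  assumes "quot_field k D = carrier k" "finite X" "X \<subseteq> localization_at K T M"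
  shows "\<exists>s\<in>R - M. \<forall>x\<in>X. s \<otimes> x \<in> R"
  using assms(2,3)
proof (induction X rule: finite_induct)
  case empty
  then show ?case using one_notin_M R_simps(2) by blast
next
  case (insert x X)
  then obtain r where r: "r \<in> R" "r \<notin> M" "\<And>x. x \<in> X \<Longrightarrow> r \<otimes> x \<in> R" by auto
  have "x \<in> localization_at K T M" using insert.prems by blast
  then obtain s where s: "x \<in> carrier K" "s \<in> T" "s \<notin> M" "s \<otimes> x \<in> T"
    unfolding localization_iff by blast
  have "\<phi> s \<noteq> \<zero>\<^bsub>k\<^esub>" using s M_iff by (auto simp del: in_T)
  note i = k.inv_simps[OF phi_carrier[OF s(2)] this]
  have "\<phi> (s \<otimes> x) \<otimes>\<^bsub>k\<^esub> inv\<^bsub>k\<^esub> \<phi> s \<in> quot_field k D"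
    using assms(1) i(1) s(4) by (simp del: phi_mult)
  then obtain d e where de: "\<phi> (s \<otimes> x) \<otimes>\<^bsub>k\<^esub> inv\<^bsub>k\<^esub> \<phi> s = d \<otimes>\<^bsub>k\<^esub> inv\<^bsub>k\<^esub> e"
    "d \<in> D" "e \<in> D" "e \<noteq> \<zero>\<^bsub>k\<^esub>" unfolding quot_field_def by blast
  note ie = k.inv_simps[OF D_carrier[OF de(3)] de(4)]
  \<comment> \<open>The choice of \<open>u\<close> makes the residues of
    \<open>u \<otimes> s\<close> and \<open>u \<otimes> (s \<otimes> x)\<close> equal to
    \<open>e\<close> and \<open>d\<close>; both products are therefore in \<open>R\<close>, and the
    first is outside \<open>M\<close> as \<open>e\<close> is nonzero.\<close>
  obtain u where u: "u \<in> T" "\<phi> u = inv\<^bsub>k\<^esub> \<phi> s \<otimes>\<^bsub>k\<^esub> e"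
    using phi_surj[of "inv\<^bsub>k\<^esub> \<phi> s \<otimes>\<^bsub>k\<^esub> e"] i(1) de(3) by auto
  have "\<phi> (u \<otimes> s) = e \<otimes>\<^bsub>k\<^esub> (inv\<^bsub>k\<^esub> \<phi> s \<otimes>\<^bsub>k\<^esub> \<phi> s)"
    using u s(2) i(1) de(3) by (simp add: k.m_ac)
  then have us: "\<phi> (u \<otimes> s) = e" using i(4) de(3) by simp
  have "\<phi> (u \<otimes> (s \<otimes> x)) = e \<otimes>\<^bsub>k\<^esub> (\<phi> (s \<otimes> x) \<otimes>\<^bsub>k\<^esub> inv\<^bsub>k\<^esub> \<phi> s)"
    using u s(4) i(1) de(3) phi_carrier[OF s(4)] phi_mult[OF u(1) s(4)] by (simp add: k.m_ac)
  also have "\<dots> = d \<otimes>\<^bsub>k\<^esub> (e \<otimes>\<^bsub>k\<^esub> inv\<^bsub>k\<^esub> e)"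
    unfolding de(1) using de(2,3) ie(1) by (simp add: k.m_lcomm)
  finally have usx: "\<phi> (u \<otimes> (s \<otimes> x)) = d" using ie(3) de(2) by simp
  have usR: "u \<otimes> s \<in> R" "u \<otimes> s \<notin> M" "u \<otimes> (s \<otimes> x) \<in> R"
    unfolding R_iff M_iff using us usx de(2-4) u(1) s(2,4) by (simp_all del: phi_mult)
  have rc: "r \<in> carrier K" "u \<otimes> s \<in> carrier K" using r usR by auto
  let ?s = "(u \<otimes> s) \<otimes> r"
  have "?s \<in> R - M" using M_prime usR r by simp
  moreover have "?s \<otimes> y \<in> R" if "y \<in> insert x X" for y
  proof (cases "y = x")
    case True
    have "?s \<otimes> y = r \<otimes> (u \<otimes> (s \<otimes> x))" using True rc s(1,2) u(1) by (simp add: m_ac)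
    then show ?thesis using usR r by simp
  next
    case False
    then have y: "y \<in> X" "y \<in> carrier K" using that insert.prems localization_iff by auto
    have "?s \<otimes> y = (u \<otimes> s) \<otimes> (r \<otimes> y)" using rc y by (simp add: m_assoc)
    then show ?thesis using usR r(3) y by simp
  qed
  ultimately show ?case by blast
qed

text \<open>The colon of an \<open>R\<close>-module by \<open>M\<close> is a module over the larger
  ring \<open>T\<close>, because \<open>M\<close> is an ideal of \<open>T\<close>. Inclusions of
  \<open>T\<close>-spans in it can thus be checked on generators.\<close>

lemma is_submodule_colon_M:
  assumes "is_submodule K R E"
  shows "is_submodule K T {x \<in> carrier K. \<forall>m\<in>M. m \<otimes> x \<in> E}"
proof (rule is_submoduleI)
  note E = is_submoduleD[OF assms]
  show "a \<otimes> x \<in> {x \<in> carrier K. \<forall>m\<in>M. m \<otimes> x \<in> E}"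
    if a: "a \<in> T" and x: "x \<in> {x \<in> carrier K. \<forall>m\<in>M. m \<otimes> x \<in> E}" for a x
  proof -
    have "m \<otimes> (a \<otimes> x) \<in> E" if m: "m \<in> M" for m
    proof -
      have "m \<otimes> (a \<otimes> x) = (m \<otimes> a) \<otimes> x" using a x m by (simp add: m_assoc)
      then show ?thesis using x M_mult(2)[OF a m] by auto
    qed
    then show ?thesis using a x by auto
  qed
qed (use is_submoduleD[OF assms] in \<open>auto simp: r_distr\<close>)

text \<open>If \<open>j\<close> sends \<open>S\<close> into \<open>T\<close>, then
  \<open>m \<otimes> j\<close> sends \<open>S\<close> into \<open>M\<close>, hence into
  \<open>R\<close>. A factor from \<open>M\<close> therefore turns elements of the inverse over
  \<open>T\<close> into elements of the inverse over \<open>R\<close>.\<close>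

lemma M_times_inv_prod:
  assumes S: "finite S" "S \<subseteq> carrier K" and m: "m \<in> M" and z: "z \<in> T.inv_prod S"
  shows "m \<otimes> z \<in> R.inv_prod S"
proof -
  let ?Q = "{x \<in> carrier K. \<forall>m\<in>M. m \<otimes> x \<in> R.inv_prod S}"
  note Q = is_submodule_colon_M[OF R.is_submodule_inv_prod[OF S]]
  have "T.inv_prod S \<subseteq> ?Q"
    unfolding T.inv_prod_def
  proof (rule ideal_prod_least[OF Q])
    fix i j assume i: "i \<in> module_span K T S" and j: "j \<in> {x \<in> carrier K. \<forall>s\<in>S. x \<otimes> s \<in> T}"
    have "is_submodule K T {x \<in> carrier K. j \<otimes> x \<in> ?Q}"
      using j T.A_sub by (intro is_submodule_mult_vimage Q) auto
    moreover have "j \<otimes> s \<in> ?Q" if s: "s \<in> S" for s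
    proof -
      have sc: "s \<in> carrier K" using s S by auto
      have "m \<otimes> (j \<otimes> s) \<in> R.inv_prod S" if m: "m \<in> M" for m
      proof -
        have "s \<otimes> (m \<otimes> j) \<in> R.inv_prod S"
        proof (rule R.inv_prod_memI[OF S s])
          show "m \<otimes> j \<in> carrier K" using m j by auto
          fix t assume t: "t \<in> S"
          then have "m \<otimes> j \<otimes> t = m \<otimes> (j \<otimes> t)" using m j S(2) by (auto simp: m_assoc)
          then show "m \<otimes> j \<otimes> t \<in> R" using M_mult(2)[OF _ m, of "j \<otimes> t"] j t by auto
        qed
        moreover have "s \<otimes> (m \<otimes> j) = m \<otimes> (j \<otimes> s)" using sc m j by (simp add: m_ac)
        ultimately show ?thesis by simp
      qed
      then show ?thesis using j sc by auto
    qed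
    ultimately have "module_span K T S \<subseteq> {x \<in> carrier K. j \<otimes> x \<in> ?Q}"
      using S by (intro span_least) auto
    then show "i \<otimes> j \<in> ?Q" using i j m_comm by auto
  qed
  then show ?thesis using m z by auto
qed

text \<open>The condition \<open>\<not> S \<subseteq> M\<close> enters twice: it makes the image of
  \<open>S\<close> a nonzero generating set over \<open>D\<close>, and it supplies an
  \<open>s\<close> in \<open>S\<close> comaximal with \<open>M\<close> in \<open>T\<close>.\<close>

lemma prufer_converse_integral:
  assumes qD: "quot_field k D = carrier k"
    and PD: "prufer_star_mult_domain k D (star_projection T k \<phi> D star)"
    and PT: "prufer_star_mult_domain K T (star_extension K T star)"
    and S: "finite S" "S \<subseteq> R" "\<not> S \<subseteq> M"
  shows "\<exists>G. finite G \<and> G \<subseteq> R.inv_prod S \<and> \<not> G \<subseteq> {\<zero>} \<and> \<one> \<in> star (module_span K R G)"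
proof -
  interpret D: quot_subring k D
    using subring_D qD by (intro quot_subring.intro quot_subring_axioms.intro k.field_axioms)
  have ST: "S \<subseteq> T" and Sc: "S \<subseteq> carrier K" and Snz: "\<not> S \<subseteq> {\<zero>}" using S by auto
  obtain s where s: "s \<in> S" "s \<notin> M" using S by auto
  note spR = is_submodule_span[OF subring_R S(1) Sc] and ssR = span_superset[OF subring_R S(1) Sc]
  let ?B = "\<phi> ` S"
  have "\<phi> s \<noteq> \<zero>\<^bsub>k\<^esub>" using s ST M_iff by blast
  then have B: "finite ?B" "?B \<subseteq> carrier k" "\<not> ?B \<subseteq> {\<zero>\<^bsub>k\<^esub>}" using S(1) ST s(1) by auto
  obtain G' where G': "finite G'" "G' \<subseteq> D.inv_prod ?B" "\<not> G' \<subseteq> {\<zero>\<^bsub>k\<^esub>}"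
    "\<one> \<in> star {x \<in> T. \<phi> x \<in> module_span k D G'}"
    using PD B unfolding prufer_projection_iff[OF qD] by metis
  have G'D: "G' \<subseteq> D" using G' D.inv_prod_subset[OF B(1,2)] by auto
  then have G'c: "G' \<subseteq> carrier k" by auto
  have spG'D: "module_span k D G' \<subseteq> D"
    using G'D G'(1) by (intro k.span_least k.is_submodule_subring subring_D)
  have spG': "module_span k D G' \<subseteq> D.inv_prod ?B"
    using G' B by (intro k.span_least D.is_submodule_inv_prod)
  obtain G where G: "finite G" "G \<subseteq> T" "\<not> G \<subseteq> {\<zero>}" "\<phi> ` G \<subseteq> module_span k D G'"
    "{x \<in> T. \<phi> x \<in> module_span k D G'} \<subseteq> module_span K R G"
    using lift_generators[OF G'(1) G'c G'(3)] by metis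
  have Gc: "G \<subseteq> carrier K" using G by auto
  have oneG: "\<one> \<in> star (module_span K R G)"
    using R.star_mono[OF phi_vimage_frac_ideal R.span_frac_ideal G(5)] G(1,3) Gc G'(4) spG'D
      k.is_submodule_span[OF subring_D G'(1) G'c] by blast
  have spT: "module_span K R S \<subseteq> T"
    using S ST is_submodule_antimono[OF is_submodule_subring[OF subring_T], of R]
    by (intro span_least) auto
  have invT: "R.inv_prod S \<subseteq> T" using R.inv_prod_subset[OF S(1) Sc] by auto
  \<comment> \<open>Any lift of an element of the inverse over \<open>D\<close> belongs to the
    inverse over \<open>R\<close>, since membership in \<open>R\<close> is decided by residues. So
    every element of \<open>G\<close> is congruent modulo \<open>M\<close> to one of
    \<open>R.inv_prod S\<close>.\<close>
  have "D.inv_prod ?B \<subseteq> \<phi> ` R.inv_prod S"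
    unfolding D.inv_prod_def
  proof (rule ideal_prod_least)
    show "is_submodule k D (\<phi> ` R.inv_prod S)"
      by (intro is_submodule_phi_image R.is_submodule_inv_prod S Sc invT)
    fix i j assume i: "i \<in> module_span k D ?B"
      and j: "j \<in> {x \<in> carrier k. \<forall>b\<in>?B. x \<otimes>\<^bsub>k\<^esub> b \<in> D}"
    have "module_span k D ?B \<subseteq> \<phi> ` module_span K R S"
      using ssR by (intro k.span_least is_submodule_phi_image spR spT B) auto
    then obtain i' where i': "i' \<in> module_span K R S" "i = \<phi> i'" using i by auto
    obtain j' where j': "j' \<in> T" "j = \<phi> j'" using phi_surj j by blast
    have "j' \<otimes> t \<in> R" if "t \<in> S" for t using that j j' ST R_iff by (auto simp del: in_T)
    then have "i' \<otimes> j' \<in> R.inv_prod S"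
      unfolding R.inv_prod_def using i' j' by (intro ideal_prod.prod) auto
    moreover have "i \<otimes>\<^bsub>k\<^esub> j = \<phi> (i' \<otimes> j')" using i' j' spT by auto
    ultimately show "i \<otimes>\<^bsub>k\<^esub> j \<in> \<phi> ` R.inv_prod S" by blast
  qed
  then have Glift: "\<exists>q\<in>R.inv_prod S. \<phi> g = \<phi> q" if "g \<in> G" for g
    using that G(4) spG' by blast
  obtain J where J: "finite J" "J \<subseteq> T.inv_prod S" "\<not> J \<subseteq> {\<zero>}" "\<one> \<in> star (module_span K T J)"
    using PT S(1) Sc Snz unfolding prufer_extension_iff star_extension_def by (metis IntD1)
  have JT: "J \<subseteq> T" using J T.inv_prod_subset[OF S(1) Sc] by auto
  have Jc: "J \<subseteq> carrier K" using JT by auto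
  note QT = is_submoduleD[OF T.is_submodule_inv_prod[OF S(1) Sc]]
    and QR = is_submoduleD[OF R.is_submodule_inv_prod[OF S(1) Sc]]
  have sT: "s \<in> T" using s ST by auto
  obtain u m where um: "u \<in> T" "m \<in> M" "u \<otimes> s \<oplus> m = \<one>" using inverse_mod_M[OF sT s(2)] .
  let ?j = "u \<otimes> s"
  \<comment> \<open>As \<open>S\<close> lies in \<open>T\<close>, the inverse over \<open>T\<close>
    contains \<open>\<one>\<close>, so \<open>s\<close> and its multiple \<open>?j\<close> lie in
    the product. The residue of \<open>?j\<close> is 1, which places \<open>?j\<close> in
    \<open>R\<close>.\<close>
  have "s \<otimes> \<one> \<in> T.inv_prod S" using ST Sc by (intro T.inv_prod_memI S(1) s(1)) auto
  then have jQ: "?j \<in> T.inv_prod S" using QT(4)[OF um(1)] sT by simp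
  have jT: "?j \<in> T" using um sT by simp
  have "\<phi> m = \<zero>\<^bsub>k\<^esub>" using um(2) M_iff by blast
  then have "\<phi> (?j \<oplus> m) = \<phi> ?j" using jT um(2) by (simp del: phi_mult)
  then have j1: "\<phi> ?j = \<one>\<^bsub>k\<^esub>" using um(3) by (simp del: phi_mult phi_add)
  \<comment> \<open>Since \<open>?j \<oplus> m = \<one>\<close>, \<open>H\<close> generates the same ideal of \<open>T\<close> as \<open>insert ?j J\<close>, but lies in \<open>R\<close>.\<close>
  define H where "H = insert ?j ((\<lambda>x. x \<otimes> m) ` J)"
  have HQ: "H \<subseteq> T.inv_prod S"
  proof -
    have "x \<otimes> m \<in> T.inv_prod S" if x: "x \<in> J" for x
    proof -
      have "m \<otimes> x \<in> T.inv_prod S" using QT(4)[of m x] x J(2) um(2) by auto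
      moreover have "x \<otimes> m = m \<otimes> x" using x Jc um(2) by (intro m_comm) auto
      ultimately show ?thesis by simp
    qed
    then show ?thesis unfolding H_def using jQ by auto
  qed
  have HR: "H \<subseteq> R"
    unfolding H_def using jT j1 D_simps(2) R_iff M_mult(1)[OF _ um(2)] JT by (auto simp del: in_T)
  have Hc: "H \<subseteq> carrier K" using HR by auto
  have Hf: "finite H" unfolding H_def using J by simp
  have Hnz: "\<not> H \<subseteq> {\<zero>}"
  proof
    assume "H \<subseteq> {\<zero>}"
    then have "?j = \<zero>" unfolding H_def by auto
    then show False using j1 by simp
  qed
  note spH = is_submodule_span[OF subring_R Hf Hc] and ssH = span_superset[OF subring_R Hf Hc]
  have fJ: "module_span K T J \<in> frac_ideals K R"
    by (intro frac_ideal_T_R T.span_frac_ideal J Jc)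
  have fH: "module_span K R H \<in> frac_ideals K R" by (intro R.span_frac_ideal Hf Hc Hnz)
  \<comment> \<open>Multiplication by \<open>M\<close> takes the \<open>T\<close>-span of
    \<open>J\<close> into the \<open>R\<close>-span of \<open>H\<close>: in the expansion of
    \<open>n \<otimes> x\<close> the coefficients \<open>n \<otimes> x\<close> and \<open>n\<close>
    lie in \<open>M\<close>. Scaling \<open>\<one>\<close> by \<open>m\<close> then puts
    \<open>m\<close> into the closure, and adding \<open>?j\<close> gives
    \<open>\<one>\<close>.\<close>
  have "module_span K T J \<subseteq> {x \<in> carrier K. \<forall>m\<in>M. m \<otimes> x \<in> module_span K R H}"
  proof (intro span_least is_submodule_colon_M spH J(1) subsetI)
    fix x assume x: "x \<in> J"
    have xT: "x \<in> T" using x JT by auto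
    have "n \<otimes> x \<in> module_span K R H" if n: "n \<in> M" for n
    proof -
      have "n \<otimes> x = n \<otimes> x \<otimes> (?j \<oplus> m)" using um(3) n xT by simp
      also have "\<dots> = (n \<otimes> x) \<otimes> ?j \<oplus> n \<otimes> (x \<otimes> m)"
        using n xT jT um(2) by (simp add: r_distr m_assoc)
      finally have eq: "n \<otimes> x = (n \<otimes> x) \<otimes> ?j \<oplus> n \<otimes> (x \<otimes> m)" .
      have "?j \<in> module_span K R H" "x \<otimes> m \<in> module_span K R H"
        using ssH x unfolding H_def by auto
      then have "(n \<otimes> x) \<otimes> ?j \<in> module_span K R H" "n \<otimes> (x \<otimes> m) \<in> module_span K R H"
        using is_submoduleD(4)[OF spH] M_mult(2)[OF xT n] n by auto
      then show ?thesis using is_submoduleD(3)[OF spH] eq by metis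
    qed
    then show "x \<in> {x \<in> carrier K. \<forall>m\<in>M. m \<otimes> x \<in> module_span K R H}" using xT by auto
  qed
  then have "m \<otimes> \<one> \<in> star (module_span K R H)"
    using um(2) by (intro R.star_scale[OF fJ fH _ _ J(4)]) auto
  moreover have "?j \<in> star (module_span K R H)"
    using R.star_extensive[OF fH] ssH unfolding H_def by auto
  ultimately have "?j \<oplus> m \<in> star (module_span K R H)"
    using is_submoduleD(3)[OF R.is_submodule_star[OF fH]] um(2) by simp
  then have oneH: "\<one> \<in> star (module_span K R H)" using um(3) by simp
  let ?P = "(\<lambda>(g, h). g \<otimes> h) ` (G \<times> H)"
  note P = R.one_in_star_span_times[OF G(1) Gc G(3) oneG Hf Hc Hnz oneH refl]
  have "?P \<subseteq> R.inv_prod S"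
  proof clarify
    fix g h assume g: "g \<in> G" and h: "h \<in> H"
    obtain q where q: "q \<in> R.inv_prod S" "\<phi> g = \<phi> q" using Glift[OF g] by auto
    have gT: "g \<in> T" "q \<in> T" "h \<in> T" using g G(2) q invT h HR by auto
    \<comment> \<open>Split \<open>g \<otimes> h\<close> as \<open>h \<otimes> q\<close> plus
      \<open>(g \<ominus> q) \<otimes> h\<close>: the first is an \<open>R\<close>-multiple of
      \<open>q\<close>, the second a product of \<open>M\<close> with the product over
      \<open>T\<close>.\<close>
    have "(g \<ominus> q) \<otimes> h \<in> R.inv_prod S"
      using phi_diff_M q gT h HQ by (intro M_times_inv_prod S(1) Sc) auto
    moreover have "h \<otimes> q \<in> R.inv_prod S" using QR(4) q h HR by auto
    ultimately have "h \<otimes> q \<oplus> (g \<ominus> q) \<otimes> h \<in> R.inv_prod S" using QR(3) by auto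
    moreover have "h \<otimes> q \<oplus> (g \<ominus> q) \<otimes> h = g \<otimes> h"
    proof -
      have "h \<otimes> q \<oplus> (g \<ominus> q) \<otimes> h = (q \<oplus> (g \<ominus> q)) \<otimes> h"
        using gT by (simp add: l_distr m_comm[of h q])
      also have "q \<oplus> (g \<ominus> q) = g" using gT by (simp add: add_minus_cancel)
      finally show ?thesis .
    qed
    ultimately show "g \<otimes> h \<in> R.inv_prod S" by simp
  qed
  then show ?thesis using P by blast
qed

lemma prufer_converse:
  assumes qD: "quot_field k D = carrier k"
    and PD: "prufer_star_mult_domain k D (star_projection T k \<phi> D star)"
    and PT: "prufer_star_mult_domain K T (star_extension K T star)"
    and V: "valuation_domain K (localization_at K T M)"
  shows "prufer_star_mult_domain K R star"
  unfolding R.prufer_star_iff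
proof (intro allI impI)
  fix S assume S: "finite S" "S \<subseteq> carrier K" "\<not> S \<subseteq> {\<zero>}"
  obtain a where a: "a \<in> S" "a \<noteq> \<zero>" "\<And>x. x \<in> S \<Longrightarrow> inv a \<otimes> x \<in> localization_at K T M"
    using valuation_divides_all[OF V S] by auto
  have ac: "a \<in> carrier K" using a S by auto
  note i = inv_simps[OF ac a(2)]
  obtain s where s: "s \<in> R" "s \<notin> M" "\<And>x. x \<in> (\<otimes>) (inv a) ` S \<Longrightarrow> s \<otimes> x \<in> R"
    using common_denominator_outside_M[OF qD, of "(\<otimes>) (inv a) ` S"] S(1) a(3) by blast
  \<comment> \<open>Dividing by \<open>a\<close> puts \<open>S\<close> into the localization and
    \<open>s\<close> clears the denominators. The element \<open>a\<close> itself becomes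
    \<open>s\<close>, which is outside \<open>M\<close>, so the rescaled set meets the hypotheses of
    the integral case.\<close>
  let ?c = "s \<otimes> inv a"
  have c: "?c \<otimes> x = s \<otimes> (inv a \<otimes> x)" if "x \<in> carrier K" for x
    using that s(1) i(1) by (simp add: m_assoc)
  have "s \<noteq> \<zero>" using s(2) by auto
  then have c0: "?c \<in> carrier K" "?c \<noteq> \<zero>" using s(1) i(1,2) integral_iff by auto
  let ?S = "(\<otimes>) ?c ` S"
  have SR: "?S \<subseteq> R" using c s(3) S(2) by auto
  have "?c \<otimes> a = s" using c[OF ac] i s(1) by simp
  then have "s \<in> ?S" using a(1) by (metis image_eqI)
  then have SM: "\<not> ?S \<subseteq> M" using s(2) by auto
  show "\<exists>G. finite G \<and> G \<subseteq> R.inv_prod S \<and> \<not> G \<subseteq> {\<zero>} \<and> \<one> \<in> star (module_span K R G)"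
    using prufer_converse_integral[OF qD PD PT finite_imageI[OF S(1)] SR SM]
      R.inv_prod_scale[OF S(1,2) c0] by blast
qed

end

theorem theorem2p23:
  fixes K :: "('a, 'm) ring_scheme"
    and T M R :: "'a set"
    and k :: "'a set ring"
    and \<phi> :: "'a \<Rightarrow> 'a set"
    and D :: "'a set set"
    and star :: "'a set \<Rightarrow> 'a set"
  assumes "field K"
    and "subdomain T K"
    and "quot_field K T = carrier K"
    and "maximalideal M (K\<lparr>carrier := T\<rparr>)"
    and "M \<noteq> {\<zero>\<^bsub>K\<^esub>}"
    and "k = (K\<lparr>carrier := T\<rparr>) Quot M"
    and "\<phi> = (\<lambda>x. M +>\<^bsub>K\<lparr>carrier := T\<rparr>\<^esub> x)"
    and "subring D k"
    and "D \<subset> carrier k"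
    and "R = {x \<in> T. \<phi> x \<in> D}"
    and "star_operation K R star"
  shows "prufer_star_mult_domain K R star \<longleftrightarrow>
    quot_field k D = carrier k \<and>
    prufer_star_mult_domain k D (star_projection T k \<phi> D star) \<and>
    prufer_star_mult_domain K T (star_extension K T star) \<and>
    valuation_domain K (localization_at K T M)"
proof -
  let ?T = "K\<lparr>carrier := T\<rparr>"
  interpret K: field K by fact
  interpret T: domain ?T using K.subdomain_is_domain assms(2) .
  interpret M: maximalideal M ?T by fact
  interpret k: field k unfolding assms(6) using M.quotient_is_field T.is_cring by blast
  have hom: "\<phi> \<in> ring_hom ?T k" unfolding assms(6,7) using M.rcos_ring_hom .
  have "\<exists>x\<in>T. \<phi> x = z" if "z \<in> carrier k" for z
    using that unfolding assms(6,7) FactRing_def A_RCOSETS_def' by auto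
  moreover have "M = {x \<in> T. \<phi> x = \<zero>\<^bsub>k\<^esub>}"
  proof -
    \<comment> \<open>The zero of the quotient ring is the coset \<open>M\<close> itself, so the
      kernel consists of the elements whose coset is \<open>M\<close>.\<close>
    have "\<zero>\<^bsub>k\<^esub> = M" unfolding assms(6) FactRing_def by simp
    moreover have "M +>\<^bsub>?T\<^esub> x = M \<longleftrightarrow> x \<in> M" if "x \<in> T" for x
      using that M.a_rcos_const M.a_rcos_self[of x] by auto
    ultimately show ?thesis unfolding assms(7) using M.a_subset by auto
  qed
  ultimately interpret pullback K k \<phi> T M D R star
  proof (intro pullback.intro pullback_axioms.intro K.field_axioms k.field_axioms)
    show "subring T K" using assms(2) subdomain.axioms(1) subcring.axioms(1) by blast
    show "\<phi> x \<in> carrier k" if "x \<in> T" for x using ring_hom_closed[OF hom] that by simp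
    show "\<phi> (x \<oplus>\<^bsub>K\<^esub> y) = \<phi> x \<oplus>\<^bsub>k\<^esub> \<phi> y" if "x \<in> T" "y \<in> T" for x y
      using ring_hom_add[OF hom] that by simp
    show "\<phi> (x \<otimes>\<^bsub>K\<^esub> y) = \<phi> x \<otimes>\<^bsub>k\<^esub> \<phi> y" if "x \<in> T" "y \<in> T" for x y
      using ring_hom_mult[OF hom] that by simp
    show "\<phi> \<one>\<^bsub>K\<^esub> = \<one>\<^bsub>k\<^esub>" using ring_hom_one[OF hom] by simp
  qed (use assms(3,5,8-11) in auto)
  show ?thesis
    using prufer_quot_field_D prufer_projection prufer_extension prufer_valuation_domain prufer_converse
    by blast
qed

end
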